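(* Let $A$ be an $n\times n$ M-matrix. Let $S_1,\dots,S_m$ be the singular classes of $A$, ordered so that $\max(S_i)<\max(S_{i+1})$, and let $F_i,T_i$ ($1\le i\le m$) be the associated sets defined in the context. Let $(J,K)$ be a partition of $\{1,\dots,m\}$ (i.e. $J\cup K=\{1,\dots,m\}$ and $J\cap K=\emptyset$). Let $\Psi$ be the finest order preserving partition of $\{1,\dots,n\}$ encompassing the sets $F_i$, $i\in J$, and let $\Upsilon$ be the finest order preserving partition of $\{1,\dots,n\}$ encompassing the sets $T_i$, $i\in K$. Then there exists a factorization $A=LU$ such that $L$ and $U$ are $n\times n$ M-matrices, the block lower triangular self-partition of $L$ is a refinement of $\Psi$, and the block upper triangular self-partition of $U$ is a refinement of $\Upsilon$.
   Context: All matrices are real $n\times n$, and $\langle n\rangle=\{1,\dots,n\}$. An M-matrix is a matrix of the form $\alpha I-P$ with $P$ entrywise nonnegative and $\alpha\in\mathbb{R}$ at least the spectral radius of $P$ (so M-matrices may be singular). Graphs. The directed graph $\mathcal{G}(X)$ of $X=[x_{ij}]$ has vertex set $\langle n\rangle$ and edges $\{(i,j): x_{ij}\neq 0\}$. A vertex $j$ has access to $k$ (equivalently, $k$ is accessed from $j$) if there is a directed path from $j$ to $k$; the empty path is allowed, so every vertex has access to itself. The classes of $X$ are the equivalence classes of the relation "$j$ has access to $k$ and $k$ has access to $j$" in $\mathcal{G}(X)$. For $J,K\subseteq\langle n\rangle$, $X_{JK}$ is the submatrix with rows indexed by $J$ and columns indexed by $K$ (in ascending order). A class $J$ of $X$ is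 a singular class of $X$ if $X_{JJ}$ is singular. A vertex has access to (is accessed from) a class if it has access to (is accessed from) some vertex of it. Sets $F_i,T_i$. With $S_1,\dots,S_m$ the singular classes of $A$ ordered by $\max(S_i)<\max(S_{i+1})$ and $\mu_i=\max(S_i)$, $$F_i=\{l\ge\mu_i : \text{there is } j\ge l \text{ such that } j \text{ is accessed from } S_i \text{ in } \mathcal{G}(A)\},$$ $$T_i=\{l\ge\mu_i : \text{there is } j\ge l \text{ such that } j \text{ has access to } S_i \text{ in } \mathcal{G}(A)\}.$$ Partitions. An order preserving partition of $\langle n\rangle$ is a sequence $\Upsilon=(\upsilon_1,\dots,\upsilon_r)$ of pairwise disjoint sets with union $\langle n\rangle$ such that $i<j$, $i\in\upsilon_{k}$, $j\in\upsilon_{k'}$ imply $k\le k'$ (i.e. a partition into consecutive intervals). $\Psi$ is a refinement of $\Upsilon$ if both are order preserving partitions and each block of $\Psi$ is contained in a block of $\Upsilon$ (not necessarily properly). Order preserving partitions form a lattice under refinement, the greatest lower bound of two partitions having as elements the intersections of their elements. For a set $\upsilon$, let $\upsilon^+=\{l\in\langle n\rangle: l>\max(\upsilon)\}$. The block lower triangular self-partition of $X$ is the greatest lower bound (finest) of the order preserving partitions $\Upsilon$ with $X_{\upsilon_i\upsilon_i^+}=0$ for all $i$; the block upper triangular self-partition of $X$ is the greatest lower bound (finest) of the order preserving partitions $\Upsilon$ with $X_{\upsilon_i^+\upsilon_i}=0$ for all $i$. An order preserving partition encompasses sets $J_1,\dots,J_r\subseteq\langle n\rangle$ if each $J_i$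 is contained in one of its blocks; the finest order preserving partition encompassing given sets is the greatest lower bound of all order preserving partitions encompassing them (for an empty family of sets it is the partition into singletons). *)

theory Defs
  imports "Jordan_Normal_Form.Spectral_Radius" "Jordan_Normal_Form.DL_Submatrix"
begin

text \<open>Indices start at 0, following the matrix library: the vertex set of an $n \times n$
  matrix is \<open>{..<n}\<close>.\<close>

definition M_matrix :: "nat \<Rightarrow> real mat \<Rightarrow> bool" where
  "M_matrix n A \<longleftrightarrow>
     (\<exists>\<alpha> P. P \<in> carrier_mat n n \<and> (\<forall>i<n. \<forall>j<n. 0 \<le> P $$ (i, j)) \<and>
        spectral_radius (map_mat complex_of_real P) \<le> \<alpha> \<and>
        A = \<alpha> \<cdot>\<^sub>m 1\<^sub>m n - P)"

definition graph_of :: "nat \<Rightarrow> real mat \<Rightarrow> (nat \<times> nat) set" where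
  "graph_of n X = {(i, j). i < n \<and> j < n \<and> X $$ (i, j) \<noteq> 0}"

definition has_access :: "nat \<Rightarrow> real mat \<Rightarrow> nat \<Rightarrow> nat \<Rightarrow> bool" where
  "has_access n X j k \<longleftrightarrow> j < n \<and> k < n \<and> (j, k) \<in> (graph_of n X)\<^sup>*"

definition matrix_classes :: "nat \<Rightarrow> real mat \<Rightarrow> nat set set" where
  "matrix_classes n X = {..<n} // {(j, k). has_access n X j k \<and> has_access n X k j}"

definition singular_classes :: "nat \<Rightarrow> real mat \<Rightarrow> nat set set" where
  "singular_classes n X = {J \<in> matrix_classes n X. \<not> invertible_mat (submatrix X J J)}"

definition F_set :: "nat \<Rightarrow> real mat \<Rightarrow> nat set \<Rightarrow> nat set" where
  "F_set n A S = {l. l < n \<and> Max S \<le> l \<and> (\<exists>j\<ge>l. \<exists>s\<in>S. has_access n A s j)}"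

definition T_set :: "nat \<Rightarrow> real mat \<Rightarrow> nat set \<Rightarrow> nat set" where
  "T_set n A S = {l. l < n \<and> Max S \<le> l \<and> (\<exists>j\<ge>l. \<exists>s\<in>S. has_access n A j s)}"

text \<open>Blocks are required to be nonempty; otherwise refinement is not antisymmetric and
  greatest lower bounds are not unique.\<close>

definition order_preserving_partition :: "nat \<Rightarrow> nat set list \<Rightarrow> bool" where
  "order_preserving_partition n Y \<longleftrightarrow>
     {} \<notin> set Y \<and> \<Union> (set Y) = {..<n} \<and>
     (\<forall>k<length Y. \<forall>k'<length Y. k \<noteq> k' \<longrightarrow> Y ! k \<inter> Y ! k' = {}) \<and>
     (\<forall>k<length Y. \<forall>k'<length Y. \<forall>i\<in>Y ! k. \<forall>j\<in>Y ! k'. i < j \<longrightarrow> k \<le> k')"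

definition refinement :: "nat \<Rightarrow> nat set list \<Rightarrow> nat set list \<Rightarrow> bool" where
  "refinement n X Y \<longleftrightarrow>
     order_preserving_partition n X \<and> order_preserving_partition n Y \<and>
     (\<forall>x\<in>set X. \<exists>y\<in>set Y. x \<subseteq> y)"

definition is_glb_partition :: "nat \<Rightarrow> nat set list set \<Rightarrow> nat set list \<Rightarrow> bool" where
  "is_glb_partition n C X \<longleftrightarrow>
     order_preserving_partition n X \<and> (\<forall>Y\<in>C. refinement n X Y) \<and>
     (\<forall>Z. order_preserving_partition n Z \<and> (\<forall>Y\<in>C. refinement n Z Y) \<longrightarrow> refinement n Z X)"

text \<open>Well defined by \<open>ex1_glb_partition\<close> below.\<close>

definition glb_partition :: "nat \<Rightarrow> nat set list set \<Rightarrow> nat set list" where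
  "glb_partition n C = (THE X. is_glb_partition n C X)"

definition above :: "nat \<Rightarrow> nat set \<Rightarrow> nat set" where
  "above n v = {l. l < n \<and> Max v < l}"

definition lower_self_partition :: "nat \<Rightarrow> real mat \<Rightarrow> nat set list" where
  "lower_self_partition n X = glb_partition n
     {Y. order_preserving_partition n Y \<and>
         (\<forall>v\<in>set Y. submatrix X v (above n v) = 0\<^sub>m (card v) (card (above n v)))}"

definition upper_self_partition :: "nat \<Rightarrow> real mat \<Rightarrow> nat set list" where
  "upper_self_partition n X = glb_partition n
     {Y. order_preserving_partition n Y \<and>
         (\<forall>v\<in>set Y. submatrix X (above n v) v = 0\<^sub>m (card (above n v)) (card v))}"

definition encompasses :: "nat set list \<Rightarrow> nat set set \<Rightarrow> bool" where
  "encompasses Y \<J> \<longleftrightarrow> (\<forall>J\<in>\<J>. \<exists>y\<in>set Y. J \<subseteq> y)"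

definition finest_encompassing :: "nat \<Rightarrow> nat set set \<Rightarrow> nat set list" where
  "finest_encompassing n \<J> =
     glb_partition n {Y. order_preserving_partition n Y \<and> encompasses Y \<J>}"

lemma opp_block_unique:
  assumes "order_preserving_partition n Y" "x \<in> set Y" "y \<in> set Y" "i \<in> x" "i \<in> y"
  shows "x = y"
proof -
  obtain a b where ab: "a < length Y" "b < length Y" "x = Y ! a" "y = Y ! b"
    using assms(2,3) by (metis in_set_conv_nth)
  then have "a = b"
    using assms unfolding order_preserving_partition_def by blast
  with ab show ?thesis by simp
qed

lemma opp_sorted:
  assumes "order_preserving_partition n Y"
  shows "sorted_wrt (<) (map Min Y)"
proof -
  have "Min (Y ! a) < Min (Y ! b)" if ab: "a < b" "b < length Y" for a b
  proof -
    have mem: "Y ! a \<in> set Y" "Y ! b \<in> set Y" using ab by auto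
    have fin: "finite (Y ! a)" "finite (Y ! b)"
      using mem assms unfolding order_preserving_partition_def
      by (metis Sup_upper finite_lessThan finite_subset)+
    have ne: "Y ! a \<noteq> {}" "Y ! b \<noteq> {}"
      using mem assms unfolding order_preserving_partition_def by metis+
    have i: "Min (Y ! a) \<in> Y ! a" "Min (Y ! b) \<in> Y ! b" using fin ne by auto
    have "Y ! a \<inter> Y ! b = {}"
      using ab assms unfolding order_preserving_partition_def by auto
    then have "Min (Y ! a) \<noteq> Min (Y ! b)" using i by auto
    moreover have "\<not> Min (Y ! b) < Min (Y ! a)"
      using ab i assms unfolding order_preserving_partition_def
      by (meson leD less_trans)
    ultimately show ?thesis by simp
  qed
  then show ?thesis by (auto simp: sorted_wrt_iff_nth_less)
qed

lemma refinement_antisym: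
  assumes "refinement n X Y" "refinement n Y X"
  shows "X = Y"
proof -
  have sub: "set U \<subseteq> set V" if r: "refinement n U V" "refinement n V U" for U V
  proof
    fix u assume u: "u \<in> set U"
    obtain v where v: "v \<in> set V" "u \<subseteq> v" using r u unfolding refinement_def by blast
    obtain u' where u': "u' \<in> set U" "v \<subseteq> u'" using r v unfolding refinement_def by blast
    have opp: "order_preserving_partition n U" using r unfolding refinement_def by blast
    then obtain i where "i \<in> u"
      using u unfolding order_preserving_partition_def by (metis ex_in_conv)
    then have "u = u'" using opp_block_unique[OF opp u u'(1)] v u' by blast
    then show "u \<in> set V" using v u' by auto
  qed
  have eq: "set X = set Y" using sub assms by blast
  have opp: "order_preserving_partition n X" "order_preserving_partition n Y"
    using assms unfolding refinement_def by auto
  note sX = opp_sorted[OF opp(1)] and sY = opp_sorted[OF opp(2)]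
  have "map Min X = map Min Y"
    using sX sY eq by (intro strict_sorted_equal) auto
  moreover have "inj_on Min (set X \<union> set Y)"
    using sX eq by (simp add: distinct_map strict_sorted_iff)
  ultimately show ?thesis by (rule map_inj_on)
qed

lemma opp_of_equiv:
  fixes n :: nat
  assumes E: "equiv {..<n} E"
    and convex: "\<And>i j k. (i, k) \<in> E \<Longrightarrow> i \<le> j \<Longrightarrow> j \<le> k \<Longrightarrow> (i, j) \<in> E"
  shows "\<exists>Y. order_preserving_partition n Y \<and> set Y = {..<n} // E"
proof -
  define Q where "Q = {..<n} // E"
  have finQ: "finite Q" unfolding Q_def using E by (simp add: finite_quotient equiv_type)
  define xs where "xs = sorted_list_of_set (Min ` Q)"
  define Y where "Y = map (\<lambda>m. E `` {m}) xs"
  have sub: "c \<subseteq> {..<n}" if "c \<in> Q" for c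
    using that E unfolding Q_def by (metis Union_quotient Sup_upper)
  have ne: "c \<noteq> {}" if "c \<in> Q" for c
    using that E unfolding Q_def by (metis in_quotient_imp_non_empty)
  have fin: "finite c" if "c \<in> Q" for c using sub[OF that] finite_subset by blast
  have Mn: "Min c \<in> c" if "c \<in> Q" for c using fin ne that by simp
  have cls: "E `` {Min c} = c" if c: "c \<in> Q" for c
  proof -
    obtain x where x: "c = E `` {x}" using c unfolding Q_def quotient_def by auto
    then have "(x, Min c) \<in> E" using Mn[OF c] by auto
    from equiv_class_eq[OF E this] show ?thesis unfolding x[symmetric] by (rule sym)
  qed
  have "set Y = (\<lambda>c. E `` {Min c}) ` Q"
    unfolding Y_def xs_def using finQ by (simp add: image_image)
  also have "\<dots> = (\<lambda>c. c) ` Q" using cls by (intro image_cong) auto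
  finally have setY: "set Y = Q" by simp
  have xsQ: "\<exists>c\<in>Q. xs ! a = Min c \<and> Y ! a = c" if "a < length Y" for a
  proof -
    have "xs ! a \<in> Min ` Q" using that finQ unfolding Y_def xs_def
      by (metis length_map nth_mem set_sorted_list_of_set finite_imageI)
    then obtain c where "c \<in> Q" "xs ! a = Min c" by auto
    then show ?thesis using that cls unfolding Y_def by auto
  qed
  have lt: "xs ! a < xs ! b" if "a < b" "b < length Y" for a b
    using that strict_sorted_list_of_set[of "Min ` Q"]
    unfolding Y_def xs_def[symmetric] by (auto simp: sorted_wrt_iff_nth_less)
  have disj: "Y ! a \<inter> Y ! b = {}" if "a < length Y" "b < length Y" "a \<noteq> b" for a b
  proof -
    have "Y ! a \<noteq> Y ! b" using that xsQ lt by (metis nat_neq_iff)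
    moreover have "Y ! a \<in> Q" "Y ! b \<in> Q" using that setY by auto
    ultimately show ?thesis using E unfolding Q_def by (metis quotient_disj)
  qed
  have ord: "a \<le> b" if ab: "a < length Y" "b < length Y" "i \<in> Y ! a" "j \<in> Y ! b" "i < j" for a b i j
  proof (rule ccontr)
    assume "\<not> a \<le> b"
    then have "b < a" by simp
    then have l: "xs ! b < xs ! a" using lt ab by blast
    obtain c where c: "c \<in> Q" "xs ! a = Min c" "Y ! a = c" using xsQ ab by blast
    obtain d where d: "d \<in> Q" "xs ! b = Min d" "Y ! b = d" using xsQ ab by blast
    have "Min c \<le> i" using c ab fin by auto
    moreover have "(Min d, j) \<in> E" using cls d ab by blast
    ultimately have "(Min d, Min c) \<in> E" using convex[of "Min d" j "Min c"] l c d ab by auto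
    then have "Min c \<in> d" using cls d by blast
    then have "Min c \<in> Y ! a \<inter> Y ! b" using Mn c d by auto
    then show False using disj ab \<open>b < a\<close> by blast
  qed
  have "order_preserving_partition n Y"
    unfolding order_preserving_partition_def
  proof (intro conjI)
    show "{} \<notin> set Y" using setY ne by blast
    show "\<Union> (set Y) = {..<n}" using setY E unfolding Q_def by (simp add: Union_quotient)
  qed (use disj ord in blast)+
  then show ?thesis using setY Q_def by blast
qed

lemma ex1_glb_partition:
  assumes C: "\<And>Y. Y \<in> C \<Longrightarrow> order_preserving_partition n Y"
  shows "\<exists>!X. is_glb_partition n C X"
proof -
  define E where "E = {(i, j). i < n \<and> j < n \<and> (\<forall>Y\<in>C. \<exists>y\<in>set Y. i \<in> y \<and> j \<in> y)}"
  have cover: "\<exists>y\<in>set Y. i \<in> y" if "Y \<in> C" "i < n" for Y i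
  proof -
    have "\<Union> (set Y) = {..<n}"
      using C[OF that(1)] unfolding order_preserving_partition_def by simp
    then have "i \<in> \<Union> (set Y)" using that(2) by simp
    then show ?thesis by simp
  qed
  have E: "equiv {..<n} E"
  proof (rule equivI)
    show "E \<subseteq> {..<n} \<times> {..<n}" unfolding E_def by auto
    show "refl_on {..<n} E" unfolding E_def refl_on_def using cover by auto
    show "sym E" unfolding E_def sym_def by blast
    show "trans E"
    proof (rule transI)
      fix i j k assume ij: "(i, j) \<in> E" and jk: "(j, k) \<in> E"
      have "\<exists>y\<in>set Y. i \<in> y \<and> k \<in> y" if YC: "Y \<in> C" for Y
      proof -
        obtain y where y: "y \<in> set Y" "i \<in> y" "j \<in> y"
          using YC ij unfolding E_def by blast
        obtain z where z: "z \<in> set Y" "j \<in> z" "k \<in> z"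
          using YC jk unfolding E_def by blast
        have "y = z" by (rule opp_block_unique[OF C[OF YC] y(1) z(1) y(3) z(2)])
        then show ?thesis using y z by blast
      qed
      then show "(i, k) \<in> E" using ij jk unfolding E_def by blast
    qed
  qed
  have convex: "(i, j) \<in> E" if ik: "(i, k) \<in> E" and le: "i \<le> j" "j \<le> k" for i j k
  proof -
    have jn: "i < n" "j < n" using ik le unfolding E_def by auto
    have "\<exists>y\<in>set Y. i \<in> y \<and> j \<in> y" if YC: "Y \<in> C" for Y
    proof -
      obtain y where y: "y \<in> set Y" "i \<in> y" "k \<in> y" using ik YC unfolding E_def by blast
      obtain a where a: "a < length Y" "Y ! a = y" using y by (metis in_set_conv_nth)
      obtain z where z: "z \<in> set Y" "j \<in> z" using cover[OF YC jn(2)] by blast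
      obtain b where b: "b < length Y" "Y ! b = z" using z by (metis in_set_conv_nth)
      have o: "\<And>p q s t. p < length Y \<Longrightarrow> q < length Y \<Longrightarrow> s \<in> Y ! p \<Longrightarrow> t \<in> Y ! q \<Longrightarrow> s < t \<Longrightarrow> p \<le> q"
        using C[OF YC] unfolding order_preserving_partition_def by blast
      show ?thesis
      proof (cases "i = j \<or> j = k")
        case True then show ?thesis using y by blast
      next
        case False
        then have "a \<le> b" "b \<le> a" using o[of a b i j] o[of b a j k] a b y z le by auto
        then have "a = b" by simp
        then show ?thesis using a b y z by auto
      qed
    qed
    then show ?thesis using jn unfolding E_def by blast
  qed
  obtain X where X: "order_preserving_partition n X" and sX: "set X = {..<n} // E"
    using opp_of_equiv[OF E] convex by blast
  have "refinement n X Y" if YC: "Y \<in> C" for Y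
    unfolding refinement_def
  proof (intro conjI ballI X C[OF YC])
    fix x assume "x \<in> set X"
    then obtain i where i: "i < n" "x = E `` {i}" unfolding sX quotient_def by auto
    obtain y where y: "y \<in> set Y" "i \<in> y" using cover[OF YC i(1)] by blast
    have "x \<subseteq> y"
    proof
      fix j assume "j \<in> x"
      then obtain z where "z \<in> set Y" "i \<in> z" "j \<in> z" using i YC unfolding E_def by blast
      then show "j \<in> y" using y opp_block_unique[OF C[OF YC]] by blast
    qed
    then show "\<exists>y\<in>set Y. x \<subseteq> y" using y by blast
  qed
  moreover have "refinement n Z X"
    if Z: "order_preserving_partition n Z" and ZC: "\<And>Y. Y \<in> C \<Longrightarrow> refinement n Z Y" for Z
    unfolding refinement_def
  proof (intro conjI ballI Z X)
    fix z assume z: "z \<in> set Z"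
    then obtain i where i: "i \<in> z"
      using Z unfolding order_preserving_partition_def by (metis ex_in_conv)
    have "\<Union> (set Z) = {..<n}" using Z unfolding order_preserving_partition_def by simp
    then have zn: "z \<subseteq> {..<n}" using z by auto
    have "(i, j) \<in> E" if j: "j \<in> z" for j
    proof -
      have "\<exists>y\<in>set Y. i \<in> y \<and> j \<in> y" if YC: "Y \<in> C" for Y
      proof -
        obtain y where "y \<in> set Y" "z \<subseteq> y"
          using ZC[OF YC] z unfolding refinement_def by auto
        then show ?thesis using i j by auto
      qed
      moreover have "i < n" "j < n" using i j zn by auto
      ultimately show ?thesis unfolding E_def by simp
    qed
    then have "z \<subseteq> E `` {i}" by auto
    moreover have "E `` {i} \<in> set X" unfolding sX using i zn by (auto intro: quotientI)
    ultimately show "\<exists>x\<in>set X. z \<subseteq> x" by (rule bexI)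
  qed
  ultimately have glb: "is_glb_partition n C X" unfolding is_glb_partition_def using X by simp
  show ?thesis
  proof (rule ex1I[of _ X])
    show "is_glb_partition n C X" by (rule glb)
    fix X' assume "is_glb_partition n C X'"
    then have "refinement n X' X" "refinement n X X'"
      using glb unfolding is_glb_partition_def by simp_all
    then show "X' = X" by (rule refinement_antisym)
  qed
qed

end

theory Submission
  imports Defs
begin

text \<open>The factorization is built by recursion on the set of indices that remain, always looking at
  the least one, \<open>v\<close>. If the diagonal entry of \<open>v\<close> is positive, one step of Gaussian elimination
  peels off a triangular row and column and leaves a Schur complement. If it is zero, let \<open>R\<close> be
  the set of vertices accessed from \<open>v\<close> and \<open>Q\<close> the rest, so that the block \<open>RQ\<close> of the matrix \<open>B\<close>
  vanishes. With the indices of \<open>R\<close> listed first, and with \<open>B\<^sub>Q\<^sub>Q = L\<^sub>Q U\<^sub>Q\<close> from the recursion,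
  \<open>B\<close> is the product of the block matrices \<open>L = [[B\<^sub>R\<^sub>R, 0], [B\<^sub>Q\<^sub>R, L\<^sub>Q]]\<close> and
  \<open>U = [[I, 0], [0, U\<^sub>Q]]\<close>.
  The entries of \<open>L\<close> above the diagonal that arise at this step lie in columns \<open>j \<in> R\<close>. Such a \<open>j\<close> is
  accessed from \<open>v\<close>, also in the original graph, as elimination creates no new access. So if \<open>v\<close>
  is the maximum of a singular class, all indices from \<open>v\<close> to \<open>j\<close> belong to the set \<open>F\<close> of that
  class, and the entry is admissible. If \<open>R\<close> is instead the set of vertices with access to \<open>v\<close>, the
  roles of \<open>L\<close> and \<open>U\<close> (and of \<open>F\<close> and \<open>T\<close>) are exchanged. This recursion is \<open>M_on_block_LU\<close>.

  A zero on the diagonal has to be traced back to a singular class \<open>S\<close> of the original matrix with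
  \<open>Max S = v\<close>. For this, a set \<open>C\<close> of mutually accessible vertices is called critical if
  \<open>B\<^sub>C\<^sub>C x \<le> 0\<close> for some \<open>x > 0\<close>. A vertex with zero diagonal entry is critical by itself; critical
  sets lift through the elimination of the least index without a change of the maximum
  (\<open>critical_Max_schur\<close>); and a critical set of an M-matrix is a singular class
  (\<open>critical_imp_singular_class\<close>), because an irreducible M-matrix sends no nonnegative vector to a
  nonzero nonpositive one.

  All of this becomes elementary once the spectral condition is replaced by an equivalent one: a
  matrix with nonpositive off-diagonal entries is an M-matrix iff for no nonempty \<open>C\<close> and no \<open>x > 0\<close>
  is every entry of \<open>B\<^sub>C\<^sub>C x\<close> negative (\<open>M_matrix_imp_M_on\<close>, \<open>M_on_imp_M_matrix\<close>). Principal
  submatrices, block triangular matrices and Schur complements inherit this condition at once.\<close>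

section \<open>A sign characterization of M-matrices\<close>

text \<open>The entries of \<open>B\<close> indexed by \<open>V\<close> form an M-matrix. Nonpositivity off the diagonal is
  explicit; the bound on the spectral radius is expressed by the absence of a nonempty \<open>C\<close> and an
  \<open>x > 0\<close> on \<open>C\<close> for which all entries of \<open>B\<^sub>C\<^sub>C x\<close> are negative. The matrix is a function on all
  indices so that principal submatrices are obtained by shrinking \<open>V\<close>.\<close>

definition M_on :: "'a set \<Rightarrow> ('a \<Rightarrow> 'a \<Rightarrow> real) \<Rightarrow> bool" where
  "M_on V B \<longleftrightarrow>
     (\<forall>i\<in>V. \<forall>j\<in>V. i \<noteq> j \<longrightarrow> B i j \<le> 0) \<and>
     (\<forall>C x. C \<subseteq> V \<longrightarrow> C \<noteq> {} \<longrightarrow> (\<forall>i\<in>C. 0 < x i) \<longrightarrow> (\<exists>i\<in>C. 0 \<le> (\<Sum>j\<in>C. B i j * x j)))"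

lemma M_on_offdiag: "M_on V B \<Longrightarrow> i \<in> V \<Longrightarrow> j \<in> V \<Longrightarrow> i \<noteq> j \<Longrightarrow> B i j \<le> 0"
  unfolding M_on_def by blast

lemma M_on_not_neg:
  assumes "M_on V B" "C \<subseteq> V" "C \<noteq> {}" "\<And>i. i \<in> C \<Longrightarrow> 0 < x i"
  obtains i where "i \<in> C" "0 \<le> (\<Sum>j\<in>C. B i j * x j)"
  using assms unfolding M_on_def by meson

lemma M_on_diag:
  assumes "M_on V B" "i \<in> V"
  shows "0 \<le> B i i"
  using M_on_not_neg[OF assms(1), of "{i}" "\<lambda>_. 1"] assms(2) by auto

lemma M_on_subset: "M_on V B \<Longrightarrow> W \<subseteq> V \<Longrightarrow> M_on W B"
  unfolding M_on_def by (meson subset_iff)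

lemma M_on_cong:
  assumes "\<And>i j. i \<in> V \<Longrightarrow> j \<in> V \<Longrightarrow> B i j = B' i j" "M_on V B"
  shows "M_on V B'"
  unfolding M_on_def
proof (intro conjI allI impI)
  show "\<forall>i\<in>V. \<forall>j\<in>V. i \<noteq> j \<longrightarrow> B' i j \<le> 0" using assms M_on_offdiag by metis
  fix C x assume C: "C \<subseteq> V" "C \<noteq> {}" "\<forall>i\<in>C. 0 < (x i :: real)"
  obtain i where i: "i \<in> C" "0 \<le> (\<Sum>j\<in>C. B i j * x j)"
    using M_on_not_neg[OF assms(2) C(1,2)] C(3) by blast
  have "(\<Sum>j\<in>C. B i j * x j) = (\<Sum>j\<in>C. B' i j * x j)"
    using assms(1) i(1) C(1) by (intro sum.cong) (auto simp: subset_iff)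
  then show "\<exists>i\<in>C. 0 \<le> (\<Sum>j\<in>C. B' i j * x j)" using i by (intro bexI[of _ i]) auto
qed

lemma M_on_diagonal:
  assumes "\<And>i. i \<in> V \<Longrightarrow> 0 \<le> B i i" "\<And>i j. i \<in> V \<Longrightarrow> j \<in> V \<Longrightarrow> i \<noteq> j \<Longrightarrow> B i j = 0"
  shows "M_on V B"
  unfolding M_on_def
proof (intro conjI allI impI)
  show "\<forall>i\<in>V. \<forall>j\<in>V. i \<noteq> j \<longrightarrow> B i j \<le> 0" using assms by auto
  fix C x assume C: "C \<subseteq> V" "C \<noteq> {}" "\<forall>i\<in>C. 0 < (x i :: real)"
  then obtain i where i: "i \<in> C" by blast
  have "0 \<le> (\<Sum>j\<in>C. B i j * x j)"
  proof (rule sum_nonneg)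
    fix j assume j: "j \<in> C"
    show "0 \<le> B i j * x j"
    proof (cases "i = j")
      case True
      then show ?thesis using assms(1)[of i] i C(1,3) by (metis less_imp_le mult_nonneg_nonneg subsetD)
    next
      case False
      then have "B i j = 0" using assms(2) i j C(1) by blast
      then show ?thesis by simp
    qed
  qed
  then show "\<exists>i\<in>C. 0 \<le> (\<Sum>j\<in>C. B i j * x j)" using i by blast
qed

lemma M_on_block_triangular:
  assumes "finite V" "V = R \<union> Q" "M_on R B" "M_on Q B"
    and zero: "\<And>i j. i \<in> R \<Longrightarrow> j \<in> Q \<Longrightarrow> B i j = 0"
    and nonpos: "\<And>i j. i \<in> Q \<Longrightarrow> j \<in> R \<Longrightarrow> B i j \<le> 0"
  shows "M_on V B"
  unfolding M_on_def
proof (intro conjI allI impI)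
  show "\<forall>i\<in>V. \<forall>j\<in>V. i \<noteq> j \<longrightarrow> B i j \<le> 0"
    using assms(2) M_on_offdiag[OF assms(3)] M_on_offdiag[OF assms(4)] zero nonpos
    by (metis Un_iff order_refl)
  fix C x assume C: "C \<subseteq> V" "C \<noteq> {}" "\<forall>i\<in>C. 0 < (x i :: real)"
  show "\<exists>i\<in>C. 0 \<le> (\<Sum>j\<in>C. B i j * x j)"
  proof (cases "C \<inter> R = {}")
    case True
    then have "C \<subseteq> Q" using C assms(2) by blast
    then show ?thesis using M_on_not_neg[OF assms(4) _ C(2)] C(3) by metis
  next
    case False
    obtain i where i: "i \<in> C \<inter> R" "0 \<le> (\<Sum>j\<in>C \<inter> R. B i j * x j)"
      using M_on_not_neg[OF assms(3) _ False, of x] C(3) by auto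
    have "(\<Sum>j\<in>C. B i j * x j) = (\<Sum>j\<in>C \<inter> R. B i j * x j)"
    proof (rule sum.mono_neutral_right)
      show "finite C" using C(1) assms(1) finite_subset by blast
      show "\<forall>j\<in>C - C \<inter> R. B i j * x j = 0" using zero i C(1) assms(2) by auto
    qed auto
    then show ?thesis using i by (intro bexI[of _ i]) auto
  qed
qed

lemma uniform_small_step:
  fixes f g :: "'a \<Rightarrow> real"
  assumes "finite C" "\<And>i. i \<in> C \<Longrightarrow> f i < 0"
  shows "\<exists>\<delta>>0. \<forall>d. 0 \<le> d \<longrightarrow> d \<le> \<delta> \<longrightarrow> (\<forall>i\<in>C. f i + d * g i < 0)"
  using assms
proof (induction C)
  case empty
  then show ?case by (intro exI[of _ 1]) auto
next
  case (insert c C)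
  then obtain \<delta> where \<delta>: "\<delta> > 0" "\<And>d i. 0 \<le> d \<Longrightarrow> d \<le> \<delta> \<Longrightarrow> i \<in> C \<Longrightarrow> f i + d * g i < 0"
    by auto
  have fc: "f c < 0" using insert by auto
  define \<eta> where "\<eta> = - f c / (\<bar>g c\<bar> + 1)"
  have \<eta>: "\<eta> > 0" unfolding \<eta>_def using fc by (intro divide_pos_pos) auto
  have "f c + d * g c < 0" if d: "0 \<le> d" "d \<le> \<eta>" for d
  proof (cases "d = 0")
    case False
    have "d * g c < d * (\<bar>g c\<bar> + 1)" using d False by (intro mult_strict_left_mono) auto
    also have "\<dots> \<le> \<eta> * (\<bar>g c\<bar> + 1)" using d by (intro mult_right_mono) auto
    also have "\<dots> = - f c" unfolding \<eta>_def by simp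
    finally show ?thesis by simp
  qed (use fc in simp)
  then show ?case using \<delta> \<eta> by (intro exI[of _ "min \<delta> \<eta>"]) auto
qed

lemma obtain_small_step:
  fixes f g :: "'a \<Rightarrow> real"
  assumes "finite C" "\<And>i. i \<in> C \<Longrightarrow> f i < 0"
  obtains d where "0 < d" "\<And>i. i \<in> C \<Longrightarrow> f i + d * g i < 0"
proof -
  obtain d where d: "d > 0" "\<forall>e. 0 \<le> e \<longrightarrow> e \<le> d \<longrightarrow> (\<forall>i\<in>C. f i + e * g i < 0)"
    using uniform_small_step[of C f g, OF assms] by blast
  then have "\<forall>i\<in>C. f i + d * g i < 0" by simp
  then show ?thesis using d(1) that by blast
qed

section \<open>Schur complements\<close>

text \<open>The Schur complement that remains after eliminating the index \<open>u\<close>. It is used when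
  \<open>B u u > 0\<close>, on sets not containing \<open>u\<close>.\<close>

definition schur :: "'a \<Rightarrow> ('a \<Rightarrow> 'a \<Rightarrow> real) \<Rightarrow> 'a \<Rightarrow> 'a \<Rightarrow> real" where
  "schur u B i j = B i j - B i u * B u j / B u u"

lemma sum_schur:
  "(\<Sum>j\<in>C. schur u B i j * x j) = (\<Sum>j\<in>C. B i j * x j) - B i u * (\<Sum>j\<in>C. B u j * x j) / B u u"
  unfolding schur_def
  by (simp add: algebra_simps sum_subtractf sum_distrib_left sum_divide_distrib)

lemma M_on_schur:
  assumes fin: "finite W" and u: "u \<notin> W" and M: "M_on (insert u W) B" and pos: "0 < B u u"
  shows "M_on W (schur u B)"
  unfolding M_on_def
proof (intro conjI allI impI)
  have off: "B i j \<le> 0" if "i \<in> insert u W" "j \<in> insert u W" "i \<noteq> j" for i j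
    using M_on_offdiag[OF M] that by blast
  show "\<forall>i\<in>W. \<forall>j\<in>W. i \<noteq> j \<longrightarrow> schur u B i j \<le> 0"
  proof (intro ballI impI)
    fix i j assume ij: "i \<in> W" "j \<in> W" "i \<noteq> j"
    then have "0 \<le> B i u * B u j / B u u"
      using off[of i u] off[of u j] u pos by (intro divide_nonneg_pos mult_nonpos_nonpos) auto
    then show "schur u B i j \<le> 0" unfolding schur_def using off[of i j] ij by auto
  qed
  fix C x assume C: "C \<subseteq> W" "C \<noteq> {}" and x: "\<forall>i\<in>C. 0 < (x i :: real)"
  have finC: "finite C" using C fin finite_subset by blast
  have uC: "u \<notin> C" using C u by blast
  define s where "s = (\<Sum>j\<in>C. B u j * x j)"
  have s: "s \<le> 0" unfolding s_def
  proof (intro sum_nonpos mult_nonpos_nonneg)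
    fix j assume "j \<in> C"
    then show "B u j \<le> 0" "0 \<le> x j" using off[of u j] uC C x by auto
  qed
  show "\<exists>i\<in>C. 0 \<le> (\<Sum>j\<in>C. schur u B i j * x j)"
  proof (rule ccontr)
    assume "\<not> ?thesis"
    then have neg: "(\<Sum>j\<in>C. B i j * x j) + B i u * (- s / B u u) < 0" if "i \<in> C" for i
      using that unfolding sum_schur s_def by (auto simp: not_le)
    show False
    proof (cases "s = 0")
      case True
      obtain i where "i \<in> C" "0 \<le> (\<Sum>j\<in>C. B i j * x j)"
        using M_on_not_neg[OF M _ C(2), of x] C(1) x by blast
      then show False using neg[of i] True by simp
    next
      case False
      define t where "t = - s / B u u"
      have t: "t > 0" unfolding t_def using False s pos by (intro divide_pos_pos) auto
      obtain \<delta> where \<delta>: "\<delta> > 0"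
        "\<And>d i. 0 \<le> d \<Longrightarrow> d \<le> \<delta> \<Longrightarrow> i \<in> C \<Longrightarrow>
           ((\<Sum>j\<in>C. B i j * x j) + B i u * t) + d * (- B i u) < 0"
        using uniform_small_step[OF finC, of "\<lambda>i. (\<Sum>j\<in>C. B i j * x j) + B i u * t" "\<lambda>i. - B i u"]
          neg unfolding t_def by blast
      \<comment> \<open>The value \<open>t\<close> at \<open>u\<close> annihilates row \<open>u\<close>; a slightly smaller one makes row \<open>u\<close> negative
        and leaves the rows in \<open>C\<close> negative.\<close>
      define d where "d = min \<delta> (t / 2)"
      have d: "0 < d" "d \<le> \<delta>" "d < t" unfolding d_def using \<delta> t by auto
      define y where "y = x(u := t - d)"
      have sum_y: "(\<Sum>j\<in>insert u C. B i j * y j) = B i u * (t - d) + (\<Sum>j\<in>C. B i j * x j)" for i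
      proof -
        have "(\<Sum>j\<in>C. B i j * y j) = (\<Sum>j\<in>C. B i j * x j)"
          unfolding y_def using uC by (intro sum.cong) auto
        then show ?thesis using finC uC by (simp add: y_def)
      qed
      have "(\<Sum>j\<in>insert u C. B i j * y j) < 0" if "i \<in> insert u C" for i
      proof (cases "i = u")
        case True
        have "B u u * t = - s" unfolding t_def using pos by simp
        then have "B u u * (t - d) + s = - (B u u * d)" by (simp add: algebra_simps)
        then show ?thesis unfolding True sum_y s_def[symmetric] using pos d by simp
      next
        case False
        then show ?thesis using \<delta>(2)[of d i] d that unfolding sum_y by (simp add: algebra_simps)
      qed
      moreover have "0 < y i" if "i \<in> insert u C" for i
        using that x d unfolding y_def by auto
      moreover have "insert u C \<subseteq> insert u W" "insert u C \<noteq> {}" using C(1) by auto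
      ultimately show False
        using M_on_not_neg[OF M, of "insert u C" y] by (metis not_le)
    qed
  qed
qed

section \<open>Access and critical sets\<close>

text \<open>The edges of the graph of the matrix \<open>B\<close> restricted to \<open>V\<close>; access is its reflexive
  transitive closure.\<close>

definition edges_on :: "'a set \<Rightarrow> ('a \<Rightarrow> 'a \<Rightarrow> real) \<Rightarrow> ('a \<times> 'a) set" where
  "edges_on V B = {(i, j). i \<in> V \<and> j \<in> V \<and> B i j \<noteq> 0}"

lemma edges_on_mono: "W \<subseteq> V \<Longrightarrow> (edges_on W B)\<^sup>* \<subseteq> (edges_on V B)\<^sup>*"
  by (intro rtrancl_mono) (auto simp: edges_on_def)

lemma access_schur:
  "(edges_on W (schur u B))\<^sup>* \<subseteq> (edges_on (insert u W) B)\<^sup>*"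
proof (intro rtrancl_subset_rtrancl subrelI)
  fix i j assume "(i, j) \<in> edges_on W (schur u B)"
  then have ij: "i \<in> W" "j \<in> W" "B i j \<noteq> 0 \<or> B i u \<noteq> 0 \<and> B u j \<noteq> 0"
    unfolding edges_on_def schur_def by auto
  show "(i, j) \<in> (edges_on (insert u W) B)\<^sup>*"
  proof (cases "B i j \<noteq> 0")
    case True
    then show ?thesis using ij by (auto simp: edges_on_def)
  next
    case False
    then have "(i, u) \<in> edges_on (insert u W) B" "(u, j) \<in> edges_on (insert u W) B"
      using ij by (auto simp: edges_on_def)
    then show ?thesis by (meson r_into_rtrancl rtrancl_trans)
  qed
qed

text \<open>A nonempty set of mutually accessible vertices whose principal submatrix sends some positive
  vector to a nonpositive one. The accessing paths may leave \<open>C\<close> but stay in \<open>V\<close>. For an M-matrix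
  these are exactly the singular classes, but this weaker-looking condition is easier to carry
  through elimination steps.\<close>

definition critical :: "'a set \<Rightarrow> ('a \<Rightarrow> 'a \<Rightarrow> real) \<Rightarrow> 'a set \<Rightarrow> bool" where
  "critical V B C \<longleftrightarrow> C \<noteq> {} \<and> C \<subseteq> V \<and> (\<forall>i\<in>C. \<forall>j\<in>C. (i, j) \<in> (edges_on V B)\<^sup>*) \<and>
     (\<exists>x. (\<forall>i\<in>C. 0 < x i) \<and> (\<forall>i\<in>C. (\<Sum>j\<in>C. B i j * x j) \<le> 0))"

lemma critical_mono: "critical W B C \<Longrightarrow> W \<subseteq> V \<Longrightarrow> critical V B C"
  unfolding critical_def using edges_on_mono by blast

text \<open>The lifted set contains \<open>u\<close> if \<open>C\<close> both accesses \<open>u\<close> and is accessed from it in one step; then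
  the positive vector is extended to \<open>u\<close> so that row \<open>u\<close> gives zero.\<close>

lemma critical_schur:
  assumes fin: "finite W" and u: "u \<notin> W" and M: "M_on (insert u W) B" and pos: "0 < B u u"
    and crit: "critical W (schur u B) C"
  shows "critical (insert u W) B C \<or> critical (insert u W) B (insert u C)"
proof -
  let ?E = "edges_on (insert u W) B"
  have C: "C \<noteq> {}" "C \<subseteq> W" using crit unfolding critical_def by auto
  have acc: "(i, j) \<in> ?E\<^sup>*" if "i \<in> C" "j \<in> C" for i j
    using crit access_schur[of W u B] that unfolding critical_def by blast
  obtain x where x: "\<And>i. i \<in> C \<Longrightarrow> 0 < x i" "\<And>i. i \<in> C \<Longrightarrow> (\<Sum>j\<in>C. schur u B i j * x j) \<le> 0"
    using crit unfolding critical_def by blast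
  have finC: "finite C" using C fin finite_subset by blast
  have uC: "u \<notin> C" using C u by blast
  define s where "s = (\<Sum>j\<in>C. B u j * x j)"
  have s: "s \<le> 0" unfolding s_def
  proof (intro sum_nonpos mult_nonpos_nonneg)
    fix j assume "j \<in> C"
    then show "B u j \<le> 0" "0 \<le> x j" using M_on_offdiag[OF M, of u j] uC C x(1)[of j] by auto
  qed
  have le: "(\<Sum>j\<in>C. B i j * x j) + B i u * (- s / B u u) \<le> 0" if "i \<in> C" for i
    using x(2)[OF that] unfolding sum_schur s_def by simp
  show ?thesis
  proof (cases "s \<noteq> 0 \<and> (\<exists>w\<in>C. B w u \<noteq> 0)")
    case True
    then obtain w where w: "w \<in> C" "B w u \<noteq> 0" by blast
    obtain j where j: "j \<in> C" "B u j \<noteq> 0" using True unfolding s_def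
      by (metis (no_types, lifting) mult_zero_left sum.neutral)
    have wu: "(w, u) \<in> ?E" and uj: "(u, j) \<in> ?E" using w j C by (auto simp: edges_on_def)
    have to_u: "(i, u) \<in> ?E\<^sup>*" if "i \<in> C" for i
      using acc[OF that w(1)] wu by (rule rtrancl_into_rtrancl)
    have from_u: "(u, i) \<in> ?E\<^sup>*" if "i \<in> C" for i
      using uj acc[OF j(1) that] by (rule converse_rtrancl_into_rtrancl)
    define y where "y = x(u := - s / B u u)"
    have sum_y: "(\<Sum>j\<in>insert u C. B i j * y j) = B i u * (- s / B u u) + (\<Sum>j\<in>C. B i j * x j)" for i
    proof -
      have "(\<Sum>j\<in>C. B i j * y j) = (\<Sum>j\<in>C. B i j * x j)"
        unfolding y_def using uC by (intro sum.cong) auto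
      then show ?thesis using finC uC by (simp add: y_def)
    qed
    have "\<forall>i\<in>insert u C. (\<Sum>j\<in>insert u C. B i j * y j) \<le> 0"
    proof
      fix i assume "i \<in> insert u C"
      moreover have "B u u * (- s / B u u) + s \<le> 0" using pos by simp
      ultimately show "(\<Sum>j\<in>insert u C. B i j * y j) \<le> 0"
        unfolding sum_y using le by (auto simp: s_def[symmetric] simp del: times_divide_eq_right)
    qed
    moreover have "\<forall>i\<in>insert u C. 0 < y i"
      unfolding y_def using x(1) True s pos by (auto intro: divide_neg_pos)
    moreover have "\<forall>i\<in>insert u C. \<forall>j\<in>insert u C. (i, j) \<in> ?E\<^sup>*"
      using acc to_u from_u by auto
    ultimately have "critical (insert u W) B (insert u C)"
      unfolding critical_def using C by blast
    then show ?thesis ..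
  next
    case False
    \<comment> \<open>Either \<open>s = 0\<close> or column \<open>u\<close> vanishes on \<open>C\<close>, so the correction term in \<open>le\<close> is zero.\<close>
    then have "(\<Sum>j\<in>C. B i j * x j) \<le> 0" if "i \<in> C" for i using le[OF that] that by auto
    then have "critical (insert u W) B C"
      unfolding critical_def using C acc x(1) by blast
    then show ?thesis ..
  qed
qed

lemma critical_Max_schur:
  fixes u :: "'a::linorder"
  assumes "finite W" "\<And>w. w \<in> W \<Longrightarrow> u < w" "M_on (insert u W) B" "0 < B u u"
    and crit: "critical W (schur u B) C"
  obtains C' where "critical (insert u W) B C'" "Max C' = Max C"
proof -
  have C: "C \<noteq> {}" "C \<subseteq> W" using crit unfolding critical_def by auto
  then have "finite C" using assms(1) finite_subset by blast
  then have "Max (insert u C) = max u (Max C)" "Max C \<in> C" using C by auto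
  then have "Max (insert u C) = Max C" using assms(2) C by (auto simp: max_def dest: less_imp_le)
  then show ?thesis
    using critical_schur[OF assms(1) _ assms(3,4) crit] assms(2) that by blast
qed

section \<open>The factorization\<close>

text \<open>Here \<open>EJ i j\<close> and \<open>EK i j\<close>, for \<open>i < j\<close>, say where \<open>L\<close> may be nonzero above and \<open>U\<close> below the
  diagonal. The hypothesis on critical sets demands room for every later vertex accessed from the
  maximum of the set in the first relation, or for every later vertex with access to it in the
  second one.\<close>

lemma M_on_block_LU:
  fixes V :: "'a::linorder set" and EJ EK :: "'a \<Rightarrow> 'a \<Rightarrow> bool"
  assumes "finite V" "M_on V B"
    and "\<And>C. critical V B C \<Longrightarrow>
           (\<forall>w\<ge>Max C. (Max C, w) \<in> (edges_on V B)\<^sup>* \<longrightarrow> EJ (Max C) w) \<or>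
           (\<forall>w\<ge>Max C. (w, Max C) \<in> (edges_on V B)\<^sup>* \<longrightarrow> EK (Max C) w)"
    and convJ: "\<And>p q r. p \<le> q \<Longrightarrow> q \<le> r \<Longrightarrow> EJ p r \<Longrightarrow> EJ q r"
    and convK: "\<And>p q r. p \<le> q \<Longrightarrow> q \<le> r \<Longrightarrow> EK p r \<Longrightarrow> EK q r"
  shows "\<exists>L U. M_on V L \<and> M_on V U \<and>
           (\<forall>i\<in>V. \<forall>j\<in>V. B i j = (\<Sum>k\<in>V. L i k * U k j)) \<and>
           (\<forall>i\<in>V. \<forall>j\<in>V. i < j \<longrightarrow> L i j \<noteq> 0 \<longrightarrow> EJ i j) \<and>
           (\<forall>i\<in>V. \<forall>j\<in>V. i < j \<longrightarrow> U j i \<noteq> 0 \<longrightarrow> EK i j)"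
  using assms(1-3)
proof (induction "card V" arbitrary: V B rule: less_induct)
  case less
  note finV = less.prems(1) and M = less.prems(2) and crit = less.prems(3)
  show ?case
  proof (cases "V = {}")
    case True
    then show ?thesis by (auto simp: M_on_def)
  next
    case False
    define v where "v = Min V"
    have v: "v \<in> V" "\<And>w. w \<in> V \<Longrightarrow> v \<le> w" unfolding v_def using finV False by auto
    show ?thesis
    proof (cases "B v v = 0")
      case False
      then have pos: "0 < B v v" using M_on_diag[OF M v(1)] by simp
      \<comment> \<open>Positive pivot: a step of Gaussian elimination.\<close>
      define W where "W = V - {v}"
      have V: "V = insert v W" and vW: "v \<notin> W" and finW: "finite W"
        unfolding W_def using v finV by auto
      have W_gt: "v < w" if "w \<in> W" for w using v(2)[of w] that unfolding W_def by auto
      have card: "card W < card V" unfolding V using vW finW by simp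
      have MS: "M_on W (schur v B)" using M_on_schur[OF finW vW] M pos unfolding V by blast
      have critW: "(\<forall>w\<ge>Max C. (Max C, w) \<in> (edges_on W (schur v B))\<^sup>* \<longrightarrow> EJ (Max C) w) \<or>
           (\<forall>w\<ge>Max C. (w, Max C) \<in> (edges_on W (schur v B))\<^sup>* \<longrightarrow> EK (Max C) w)"
        if C: "critical W (schur v B) C" for C
      proof -
        obtain C' where "critical V B C'" "Max C' = Max C"
          using critical_Max_schur[OF finW W_gt _ pos C] M unfolding V by blast
        then show ?thesis using crit[of C'] access_schur[of W v B] unfolding V by auto
      qed
      obtain L U where L: "M_on W L" and U: "M_on W U"
        and LU: "\<And>i j. i \<in> W \<Longrightarrow> j \<in> W \<Longrightarrow> schur v B i j = (\<Sum>k\<in>W. L i k * U k j)"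
        and EL: "\<And>i j. i \<in> W \<Longrightarrow> j \<in> W \<Longrightarrow> i < j \<Longrightarrow> L i j \<noteq> 0 \<Longrightarrow> EJ i j"
        and EU: "\<And>i j. i \<in> W \<Longrightarrow> j \<in> W \<Longrightarrow> i < j \<Longrightarrow> U j i \<noteq> 0 \<Longrightarrow> EK i j"
        using less.hyps[OF card finW MS critW] by blast
      define L' where "L' i j = (if j = v then (if i = v then 1 else B i v / B v v)
                                 else if i = v then 0 else L i j)" for i j
      define U' where "U' i j = (if i = v then B v j else if j = v then 0 else U i j)" for i j
      have L'W: "L' i j = L i j" and U'W: "U' i j = U i j" if "i \<in> W" "j \<in> W" for i j
        using that vW unfolding L'_def U'_def by auto
      have "M_on V L'"
      proof (rule M_on_block_triangular)
        show "finite V" by (rule finV)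
        show "V = {v} \<union> W" unfolding V by simp
        show "M_on {v} L'" by (rule M_on_diagonal) (auto simp: L'_def)
        show "M_on W L'" by (rule M_on_cong[OF _ L]) (simp add: L'W)
        show "L' i j = 0" if "i \<in> {v}" "j \<in> W" for i j using that vW by (auto simp: L'_def)
        show "L' i j \<le> 0" if "i \<in> W" "j \<in> {v}" for i j
          using that vW pos M_on_offdiag[OF M, of i v] unfolding V
          by (auto simp: L'_def intro: divide_nonpos_pos)
      qed
      moreover have "M_on V U'"
      proof (rule M_on_block_triangular)
        show "finite V" by (rule finV)
        show "V = W \<union> {v}" unfolding V by simp
        show "M_on {v} U'" using pos by (intro M_on_diagonal) (auto simp: U'_def)
        show "M_on W U'" by (rule M_on_cong[OF _ U]) (simp add: U'W)
        show "U' i j = 0" if "i \<in> W" "j \<in> {v}" for i j using that vW by (auto simp: U'_def)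
        show "U' i j \<le> 0" if "i \<in> {v}" "j \<in> W" for i j
          using that vW M_on_offdiag[OF M, of v j] unfolding V by (auto simp: U'_def)
      qed
      moreover have "B i j = (\<Sum>k\<in>V. L' i k * U' k j)" if ij: "i \<in> V" "j \<in> V" for i j
      proof -
        have split: "(\<Sum>k\<in>V. L' i k * U' k j) = L' i v * U' v j + (\<Sum>k\<in>W. L' i k * U' k j)"
          unfolding V using finW vW by simp
        consider "i = v" | "i \<in> W" "j = v" | "i \<in> W" "j \<in> W" using ij unfolding V by blast
        then show ?thesis
        proof cases
          case 1
          have "(\<Sum>k\<in>W. L' i k * U' k j) = 0"
            using 1 vW by (intro sum.neutral) (auto simp: L'_def)
          then show ?thesis unfolding split using 1 by (simp add: L'_def U'_def)
        next
          case 2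
          have "(\<Sum>k\<in>W. L' i k * U' k j) = 0"
            using 2 vW by (intro sum.neutral) (auto simp: U'_def)
          then show ?thesis unfolding split using 2 vW pos by (auto simp: L'_def U'_def)
        next
          case 3
          have "(\<Sum>k\<in>W. L' i k * U' k j) = (\<Sum>k\<in>W. L i k * U k j)"
            using 3 by (intro sum.cong) (simp_all add: L'W U'W)
          also have "\<dots> = schur v B i j" using LU 3 by simp
          finally show ?thesis unfolding split using 3 vW
            by (auto simp: L'_def U'_def schur_def)
        qed
      qed
      moreover have "EJ i j" if "i \<in> V" "j \<in> V" "i < j" "L' i j \<noteq> 0" for i j
      proof -
        have "j \<in> W" "i \<in> W"
          using that v(2)[of i] unfolding V L'_def by (auto split: if_splits)
        then show ?thesis using EL that L'W by metis
      qed
      moreover have "EK i j" if "i \<in> V" "j \<in> V" "i < j" "U' j i \<noteq> 0" for i j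
      proof -
        have "j \<in> W" "i \<in> W"
          using that v(2)[of i] unfolding V U'_def by (auto split: if_splits)
        then show ?thesis using EU that U'W by metis
      qed
      ultimately show ?thesis by blast
    next
      case True
      \<comment> \<open>Zero pivot: \<open>{v}\<close> is critical, and \<open>V\<close> splits along access to or from \<open>v\<close>.\<close>
      let ?E = "edges_on V B"
      have "critical V B {v}"
        unfolding critical_def using v True by (auto intro: exI[of _ "\<lambda>_. 1"])
      from crit[OF this] consider
        (J) "\<And>w. v \<le> w \<Longrightarrow> (v, w) \<in> ?E\<^sup>* \<Longrightarrow> EJ v w" |
        (K) "\<And>w. v \<le> w \<Longrightarrow> (w, v) \<in> ?E\<^sup>* \<Longrightarrow> EK v w" by auto
      then show ?thesis
      proof cases
        case J
        define R where "R = {w \<in> V. (v, w) \<in> ?E\<^sup>*}"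
        define Q where "Q = V - R"
        have V: "V = R \<union> Q" "R \<inter> Q = {}" "Q \<subseteq> V" "R \<subseteq> V" unfolding Q_def R_def by auto
        have fin: "finite R" "finite Q" using V finV finite_subset by metis+
        have vR: "v \<in> R" using v unfolding R_def by simp
        have card: "card Q < card V" unfolding Q_def using vR finV v
          by (intro psubset_card_mono) auto
        have B0: "B i j = 0" if "i \<in> R" "j \<in> Q" for i j
        proof (rule ccontr)
          assume "B i j \<noteq> 0"
          then have "(i, j) \<in> ?E" using that V unfolding edges_on_def by auto
          then show False using that unfolding Q_def R_def
            by (auto dest: rtrancl_into_rtrancl)
        qed
        have MQ: "M_on Q B" using M V M_on_subset by blast
        have critQ: "(\<forall>w\<ge>Max C. (Max C, w) \<in> (edges_on Q B)\<^sup>* \<longrightarrow> EJ (Max C) w) \<or>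
           (\<forall>w\<ge>Max C. (w, Max C) \<in> (edges_on Q B)\<^sup>* \<longrightarrow> EK (Max C) w)"
          if "critical Q B C" for C
          using crit[OF critical_mono[OF that V(3)]] edges_on_mono[OF V(3), of B] by blast
        obtain L U where L: "M_on Q L" and U: "M_on Q U"
          and LU: "\<And>i j. i \<in> Q \<Longrightarrow> j \<in> Q \<Longrightarrow> B i j = (\<Sum>k\<in>Q. L i k * U k j)"
          and EL: "\<And>i j. i \<in> Q \<Longrightarrow> j \<in> Q \<Longrightarrow> i < j \<Longrightarrow> L i j \<noteq> 0 \<Longrightarrow> EJ i j"
          and EU: "\<And>i j. i \<in> Q \<Longrightarrow> j \<in> Q \<Longrightarrow> i < j \<Longrightarrow> U j i \<noteq> 0 \<Longrightarrow> EK i j"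
          using less.hyps[OF card fin(2) MQ critQ] by blast
        define L' where "L' i j = (if j \<in> R then B i j else if i \<in> R then 0 else L i j)" for i j
        define U' where "U' i j = (if i \<in> R \<or> j \<in> R then (if i = j then 1 else 0) else U i j)" for i j
        have L'Q: "L' i j = L i j" and U'Q: "U' i j = U i j" if "i \<in> Q" "j \<in> Q" for i j
          using that V(2) unfolding L'_def U'_def by auto
        have "M_on V L'"
        proof (rule M_on_block_triangular[OF finV V(1)])
          show "M_on R L'"
            by (rule M_on_cong[OF _ M_on_subset[OF M V(4)]]) (simp add: L'_def)
          show "M_on Q L'" by (rule M_on_cong[OF _ L]) (simp add: L'Q)
          show "L' i j = 0" if "i \<in> R" "j \<in> Q" for i j using that V(2) by (auto simp: L'_def)
          show "L' i j \<le> 0" if "i \<in> Q" "j \<in> R" for i j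
            using that V M_on_offdiag[OF M, of i j] by (auto simp: L'_def)
        qed
        moreover have "M_on V U'"
        proof (rule M_on_block_triangular[OF finV V(1)])
          show "M_on R U'" by (rule M_on_diagonal) (auto simp: U'_def)
          show "M_on Q U'" by (rule M_on_cong[OF _ U]) (simp add: U'Q)
          show "U' i j = 0" if "i \<in> R" "j \<in> Q" for i j using that V(2) by (auto simp: U'_def)
          show "U' i j \<le> 0" if "i \<in> Q" "j \<in> R" for i j using that V(2) by (auto simp: U'_def)
        qed
        moreover have "B i j = (\<Sum>k\<in>V. L' i k * U' k j)" if ij: "i \<in> V" "j \<in> V" for i j
        proof (cases "j \<in> R")
          case True
          have "(\<Sum>k\<in>V. L' i k * U' k j) = (\<Sum>k\<in>V. if k = j then B i j else 0)"
            using True by (intro sum.cong) (auto simp: L'_def U'_def)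
          then show ?thesis using ij finV by simp
        next
          case False
          then have jQ: "j \<in> Q" using ij V by blast
          have "(\<Sum>k\<in>V. L' i k * U' k j) = (\<Sum>k\<in>Q. L' i k * U' k j)"
            using False finV V by (intro sum.mono_neutral_right) (auto simp: U'_def)
          also have "\<dots> = B i j"
          proof (cases "i \<in> R")
            case True
            then have "(\<Sum>k\<in>Q. L' i k * U' k j) = 0"
              using V(2) by (intro sum.neutral) (auto simp: L'_def)
            then show ?thesis using B0[OF True jQ] by simp
          next
            case False
            then have iQ: "i \<in> Q" using ij V by blast
            have "(\<Sum>k\<in>Q. L' i k * U' k j) = (\<Sum>k\<in>Q. L i k * U k j)"
              using iQ jQ by (intro sum.cong) (simp_all add: L'Q U'Q)
            then show ?thesis using LU iQ jQ by simp
          qed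
          finally show ?thesis by simp
        qed
        moreover have "EJ i j" if ij: "i \<in> V" "j \<in> V" "i < j" "L' i j \<noteq> 0" for i j
        proof (cases "j \<in> R")
          case True
          \<comment> \<open>As \<open>v\<close> is the least vertex, convexity moves the left end from \<open>v\<close> to \<open>i\<close>.\<close>
          then have "EJ v j" using J v(2) ij unfolding R_def by blast
          then show ?thesis using convJ[of v i j] v(2) ij by auto
        next
          case False
          then have "j \<in> Q" "i \<in> Q" "L i j \<noteq> 0"
            using ij V unfolding L'_def by (auto split: if_splits)
          then show ?thesis using EL ij by blast
        qed
        moreover have "EK i j" if ij: "i \<in> V" "j \<in> V" "i < j" "U' j i \<noteq> 0" for i j
        proof -
          have "j \<in> Q" "i \<in> Q" "U j i \<noteq> 0"
            using ij V unfolding U'_def by (auto split: if_splits)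
          then show ?thesis using EU ij by blast
        qed
        ultimately show ?thesis by blast
      next
        case K
        \<comment> \<open>The mirror image of the case above. It is not reduced to that case by transposing,
          because invariance of \<open>M_on\<close> under transposition would need a separate proof.\<close>
        define R where "R = {w \<in> V. (w, v) \<in> ?E\<^sup>*}"
        define Q where "Q = V - R"
        have V: "V = R \<union> Q" "R \<inter> Q = {}" "Q \<subseteq> V" "R \<subseteq> V" "V = Q \<union> R"
          unfolding Q_def R_def by auto
        have fin: "finite R" "finite Q" using V finV finite_subset by metis+
        have vR: "v \<in> R" using v unfolding R_def by simp
        have card: "card Q < card V" unfolding Q_def using vR finV v
          by (intro psubset_card_mono) auto
        have B0: "B i j = 0" if "i \<in> Q" "j \<in> R" for i j
        proof (rule ccontr)
          assume "B i j \<noteq> 0"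
          then have "(i, j) \<in> ?E" using that V unfolding edges_on_def by auto
          then show False using that unfolding Q_def R_def
            by (auto dest: converse_rtrancl_into_rtrancl)
        qed
        have MQ: "M_on Q B" using M V M_on_subset by blast
        have critQ: "(\<forall>w\<ge>Max C. (Max C, w) \<in> (edges_on Q B)\<^sup>* \<longrightarrow> EJ (Max C) w) \<or>
           (\<forall>w\<ge>Max C. (w, Max C) \<in> (edges_on Q B)\<^sup>* \<longrightarrow> EK (Max C) w)"
          if "critical Q B C" for C
          using crit[OF critical_mono[OF that V(3)]] edges_on_mono[OF V(3), of B] by blast
        obtain L U where L: "M_on Q L" and U: "M_on Q U"
          and LU: "\<And>i j. i \<in> Q \<Longrightarrow> j \<in> Q \<Longrightarrow> B i j = (\<Sum>k\<in>Q. L i k * U k j)"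
          and EL: "\<And>i j. i \<in> Q \<Longrightarrow> j \<in> Q \<Longrightarrow> i < j \<Longrightarrow> L i j \<noteq> 0 \<Longrightarrow> EJ i j"
          and EU: "\<And>i j. i \<in> Q \<Longrightarrow> j \<in> Q \<Longrightarrow> i < j \<Longrightarrow> U j i \<noteq> 0 \<Longrightarrow> EK i j"
          using less.hyps[OF card fin(2) MQ critQ] by blast
        define L' where "L' i j = (if i \<in> R \<or> j \<in> R then (if i = j then 1 else 0) else L i j)" for i j
        define U' where "U' i j = (if i \<in> R then B i j else if j \<in> R then 0 else U i j)" for i j
        have L'Q: "L' i j = L i j" and U'Q: "U' i j = U i j" if "i \<in> Q" "j \<in> Q" for i j
          using that V(2) unfolding L'_def U'_def by auto
        have "M_on V U'"
        proof (rule M_on_block_triangular[OF finV V(5)])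
          show "M_on R U'"
            by (rule M_on_cong[OF _ M_on_subset[OF M V(4)]]) (simp add: U'_def)
          show "M_on Q U'" by (rule M_on_cong[OF _ U]) (simp add: U'Q)
          show "U' i j = 0" if "i \<in> Q" "j \<in> R" for i j using that V(2) by (auto simp: U'_def)
          show "U' i j \<le> 0" if "i \<in> R" "j \<in> Q" for i j
            using that V M_on_offdiag[OF M, of i j] by (auto simp: U'_def)
        qed
        moreover have "M_on V L'"
        proof (rule M_on_block_triangular[OF finV V(1)])
          show "M_on R L'" by (rule M_on_diagonal) (auto simp: L'_def)
          show "M_on Q L'" by (rule M_on_cong[OF _ L]) (simp add: L'Q)
          show "L' i j = 0" if "i \<in> R" "j \<in> Q" for i j using that V(2) by (auto simp: L'_def)
          show "L' i j \<le> 0" if "i \<in> Q" "j \<in> R" for i j using that V(2) by (auto simp: L'_def)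
        qed
        moreover have "B i j = (\<Sum>k\<in>V. L' i k * U' k j)" if ij: "i \<in> V" "j \<in> V" for i j
        proof (cases "i \<in> R")
          case True
          have "(\<Sum>k\<in>V. L' i k * U' k j) = (\<Sum>k\<in>V. if k = i then B i j else 0)"
            using True by (intro sum.cong) (auto simp: L'_def U'_def)
          then show ?thesis using ij finV by simp
        next
          case False
          then have iQ: "i \<in> Q" using ij V by blast
          have "(\<Sum>k\<in>V. L' i k * U' k j) = (\<Sum>k\<in>Q. L' i k * U' k j)"
            using False finV V by (intro sum.mono_neutral_right) (auto simp: L'_def)
          also have "\<dots> = B i j"
          proof (cases "j \<in> R")
            case True
            then have "(\<Sum>k\<in>Q. L' i k * U' k j) = 0"
              using V(2) by (intro sum.neutral) (auto simp: U'_def)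
            then show ?thesis using B0[OF iQ True] by simp
          next
            case False
            then have jQ: "j \<in> Q" using ij V by blast
            have "(\<Sum>k\<in>Q. L' i k * U' k j) = (\<Sum>k\<in>Q. L i k * U k j)"
              using iQ jQ by (intro sum.cong) (simp_all add: L'Q U'Q)
            then show ?thesis using LU iQ jQ by simp
          qed
          finally show ?thesis by simp
        qed
        moreover have "EK i j" if ij: "i \<in> V" "j \<in> V" "i < j" "U' j i \<noteq> 0" for i j
        proof (cases "j \<in> R")
          case True
          then have "EK v j" using K v(2) ij unfolding R_def by blast
          then show ?thesis using convK[of v i j] v(2) ij by auto
        next
          case False
          then have "j \<in> Q" "i \<in> Q" "U j i \<noteq> 0"
            using ij V unfolding U'_def by (auto split: if_splits)
          then show ?thesis using EU ij by blast
        qed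
        moreover have "EJ i j" if ij: "i \<in> V" "j \<in> V" "i < j" "L' i j \<noteq> 0" for i j
        proof -
          have "j \<in> Q" "i \<in> Q" "L i j \<noteq> 0"
            using ij V unfolding L'_def by (auto split: if_splits)
          then show ?thesis using EL ij by blast
        qed
        ultimately show ?thesis by blast
      qed
    qed
  qed
qed

section \<open>Critical sets are singular classes\<close>

lemma rtrancl_within_class:
  assumes "(i, j) \<in> E\<^sup>*" "(j, i) \<in> E\<^sup>*"
    and C: "C = {k. (i, k) \<in> E\<^sup>* \<and> (k, i) \<in> E\<^sup>*}"
  shows "(i, j) \<in> (E \<inter> C \<times> C)\<^sup>*"
  using assms(1,2)
proof (induction rule: rtrancl_induct)
  case (step y z)
  then have "(y, i) \<in> E\<^sup>*" by (meson converse_rtrancl_into_rtrancl)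
  then have "(i, y) \<in> (E \<inter> C \<times> C)\<^sup>*" "(y, z) \<in> E \<inter> C \<times> C"
    using step unfolding C by (auto intro: rtrancl_into_rtrancl)
  then show ?case by (rule rtrancl_into_rtrancl)
qed simp

lemma rtrancl_crossing_edge:
  assumes "(i, j) \<in> E\<^sup>*" "i \<notin> N" "j \<in> N"
  shows "\<exists>p q. (p, q) \<in> E \<and> p \<notin> N \<and> q \<in> N"
  using assms by (induction rule: rtrancl_induct) blast+

text \<open>An irreducible M-matrix sends no nonnegative vector to a nonzero nonpositive one. Suppose that
  \<open>Bx \<le> 0\<close> with some negative entries. Raising \<open>x\<close> slightly at a vertex with a negative entry
  keeps that entry negative, increases no other entry, and makes the entry of every predecessor
  negative. By irreducibility, an \<open>x\<close> with as many negative entries of \<open>Bx\<close> as possible has only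
  negative ones; raising all its coordinates slightly makes it
  positive and contradicts the sign characterization.\<close>

lemma irreducible_subsolution_null:
  assumes fin: "finite C" and M: "M_on C B"
    and irr: "\<And>i j. i \<in> C \<Longrightarrow> j \<in> C \<Longrightarrow> (i, j) \<in> (edges_on C B)\<^sup>*"
    and x: "\<And>i. i \<in> C \<Longrightarrow> 0 \<le> x i" "\<And>i. i \<in> C \<Longrightarrow> (\<Sum>j\<in>C. B i j * x j) \<le> 0"
    and i: "i \<in> C"
  shows "(\<Sum>j\<in>C. B i j * x j) = 0"
proof (rule ccontr)
  define r where "r x i = (\<Sum>j\<in>C. B i j * x j)" for x i
  define N where "N x = {i \<in> C. r x i < 0}" for x
  define P where "P x \<longleftrightarrow> (\<forall>i\<in>C. 0 \<le> x i) \<and> (\<forall>i\<in>C. r x i \<le> 0) \<and> N x \<noteq> {}" for x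
  assume "\<not> ?thesis"
  then have "i \<in> N x" using i x(2)[OF i] unfolding N_def r_def by auto
  then have "P x" unfolding P_def using x unfolding r_def by auto
  moreover have "card (N y) < Suc (card C)" for y
    using fin unfolding N_def by (simp add: card_mono less_Suc_eq_le)
  ultimately obtain y where y: "P y" and max: "\<And>z. P z \<Longrightarrow> card (N z) \<le> card (N y)"
    using ex_has_greatest_nat[of P x "\<lambda>x. card (N x)" "Suc (card C)"] by blast
  have y0: "0 \<le> y i" "r y i \<le> 0" if "i \<in> C" for i using y that unfolding P_def by auto
  have finN: "finite (N z)" for z using fin unfolding N_def by simp
  have "N y = C"
  proof (rule ccontr)
    assume "N y \<noteq> C"
    then obtain i j where ij: "i \<in> C" "j \<in> C" "i \<notin> N y" "j \<in> N y"
      using y unfolding P_def N_def by blast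
    obtain p q where pq: "(p, q) \<in> edges_on C B" "p \<notin> N y" "q \<in> N y"
      using rtrancl_crossing_edge[OF irr[OF ij(1,2)] ij(3,4)] by blast
    then have C: "p \<in> C" "q \<in> C" "p \<noteq> q" and "B p q \<noteq> 0" unfolding edges_on_def by auto
    then have Bpq: "B p q < 0" using M_on_offdiag[OF M C] by simp
    obtain d where d: "0 < d" "\<And>i. i \<in> N y \<Longrightarrow> r y i + d * B i q < 0"
      by (rule obtain_small_step[OF finN, of y "r y" "\<lambda>i. B i q"]) (auto simp: N_def)
    define z where "z = y(q := y q + d)"
    have rz: "r z i = r y i + d * B i q" for i
    proof -
      have "r z i = (\<Sum>j\<in>C. B i j * y j + (if j = q then d * B i q else 0))"
        unfolding r_def z_def by (intro sum.cong) (auto simp: algebra_simps)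
      then show ?thesis using C fin by (simp add: r_def sum.distrib)
    qed
    have sub: "N y \<subseteq> N z" unfolding N_def using d(2) by (auto simp: rz N_def)
    have "r z i \<le> 0" if "i \<in> C" for i
    proof (cases "i = q")
      case True
      then show ?thesis using pq(3) sub unfolding N_def by auto
    next
      case False
      then have "d * B i q \<le> 0"
        using M_on_offdiag[OF M, of i q] C that d by (simp add: mult_nonneg_nonpos)
      then show ?thesis using y0(2)[OF that] unfolding rz by simp
    qed
    then have "P z" unfolding P_def using y sub d
      by (auto simp: P_def z_def)
    have "d * B p q < 0" using Bpq d by (simp add: mult_pos_neg)
    then have "p \<in> N z" using C y0(2)[of p] unfolding N_def rz by simp
    then have "N y \<subset> N z" using sub pq by blast
    then have "card (N y) < card (N z)" by (rule psubset_card_mono[OF finN])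
    then show False using max[OF \<open>P z\<close>] by simp
  qed
  then have neg: "r y i < 0" if "i \<in> C" for i using that unfolding N_def by blast
  obtain d where d: "0 < d" "\<And>i. i \<in> C \<Longrightarrow> r y i + d * (\<Sum>j\<in>C. B i j) < 0"
    by (rule obtain_small_step[OF fin, of "r y" "\<lambda>i. \<Sum>j\<in>C. B i j"]) (auto intro: neg)
  have "(\<Sum>j\<in>C. B i j * (y j + d)) = r y i + d * (\<Sum>j\<in>C. B i j)" for i
    unfolding r_def by (simp add: algebra_simps sum.distrib sum_distrib_left)
  then have "(\<Sum>j\<in>C. B i j * (y j + d)) < 0" if "i \<in> C" for i using d(2)[OF that] by simp
  moreover have "0 < y i + d" if "i \<in> C" for i using y0(1)[OF that] d(1) by simp
  ultimately show False
    using M_on_not_neg[OF M order_refl, of "\<lambda>j. y j + d"] i by (metis empty_iff not_le)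
qed

lemma critical_is_class:
  assumes fin: "finite V" and M: "M_on V B" and crit: "critical V B C" and v: "v \<in> C"
  shows "C = {k \<in> V. (v, k) \<in> (edges_on V B)\<^sup>* \<and> (k, v) \<in> (edges_on V B)\<^sup>*}"
    and "\<exists>x. (\<forall>i\<in>C. 0 < x i) \<and> (\<forall>i\<in>C. (\<Sum>j\<in>C. B i j * x j) = 0)"
proof -
  let ?E = "edges_on V B"
  define D where "D = {k. (v, k) \<in> ?E\<^sup>* \<and> (k, v) \<in> ?E\<^sup>*}"
  have vV: "v \<in> V" using crit v unfolding critical_def by blast
  have reach: "j \<in> V" if "(v, j) \<in> ?E\<^sup>*" for j
    using that vV by (induction rule: rtrancl_induct) (auto simp: edges_on_def)
  then have DV: "D \<subseteq> V" unfolding D_def by blast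
  have D: "D = {k \<in> V. (v, k) \<in> ?E\<^sup>* \<and> (k, v) \<in> ?E\<^sup>*}" using DV unfolding D_def by blast
  have finD: "finite D" using DV fin finite_subset by blast
  have CD: "C \<subseteq> D" using crit v unfolding critical_def D_def by blast
  have irr: "(i, j) \<in> (edges_on D B)\<^sup>*" if ij: "i \<in> D" "j \<in> D" for i j
  proof -
    have "(i, j) \<in> ?E\<^sup>*" "(j, i) \<in> ?E\<^sup>*"
      using ij unfolding D_def by (auto intro: rtrancl_trans)
    moreover have "D = {k. (i, k) \<in> ?E\<^sup>* \<and> (k, i) \<in> ?E\<^sup>*}"
      using ij unfolding D_def by (auto intro: rtrancl_trans)
    ultimately have "(i, j) \<in> (?E \<inter> D \<times> D)\<^sup>*" by (rule rtrancl_within_class)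
    moreover have "?E \<inter> D \<times> D = edges_on D B" using DV unfolding edges_on_def by auto
    ultimately show ?thesis by simp
  qed
  have MD: "M_on D B" using M DV M_on_subset by blast
  obtain x where x: "\<And>i. i \<in> C \<Longrightarrow> 0 < x i" "\<And>i. i \<in> C \<Longrightarrow> (\<Sum>j\<in>C. B i j * x j) \<le> 0"
    using crit unfolding critical_def by blast
  \<comment> \<open>Extended by zero to the whole class \<open>D\<close> of \<open>v\<close>, the vector \<open>x\<close> is annihilated by \<open>B\<^sub>D\<^sub>D\<close>; an
    edge from \<open>D - C\<close> into \<open>C\<close> would give a negative entry.\<close>
  define y where "y i = (if i \<in> C then x i else 0)" for i
  have sum_y: "(\<Sum>j\<in>D. B i j * y j) = (\<Sum>j\<in>C. B i j * x j)" for i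
  proof -
    have "(\<Sum>j\<in>D. B i j * y j) = (\<Sum>j\<in>C. B i j * y j)"
      using finD CD by (intro sum.mono_neutral_right) (auto simp: y_def)
    then show ?thesis by (simp add: y_def)
  qed
  have nonpos: "B i j * x j \<le> 0" if "i \<in> D - C" "j \<in> C" for i j
  proof -
    have "B i j \<le> 0" using M_on_offdiag[OF MD, of i j] that CD by blast
    then show ?thesis using x(1)[OF that(2)] by (simp add: mult_nonpos_nonneg)
  qed
  have le: "(\<Sum>j\<in>D. B i j * y j) \<le> 0" if "i \<in> D" for i
    unfolding sum_y using x(2) nonpos that by (cases "i \<in> C") (auto intro: sum_nonpos)
  have "0 \<le> y i" for i using x(1)[of i] by (auto simp: y_def)
  then have null: "(\<Sum>j\<in>C. B i j * x j) = 0" if "i \<in> D" for i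
    using irreducible_subsolution_null[OF finD MD irr _ le that] unfolding sum_y by blast
  have "C = D"
  proof (rule ccontr)
    assume "C \<noteq> D"
    then obtain i where i: "i \<in> D" "i \<notin> C" using CD by blast
    then obtain p q where pq: "(p, q) \<in> edges_on D B" "p \<notin> C" "q \<in> C"
      using rtrancl_crossing_edge[OF irr[of i v]] v CD by blast
    then have p: "p \<in> D - C" "B p q \<noteq> 0" unfolding edges_on_def by auto
    have finC: "finite C" using CD finD finite_subset by blast
    have "B p q \<le> 0" using M_on_offdiag[OF MD, of p q] p(1) pq CD by blast
    then have "B p q * x q < 0" using p(2) x(1)[OF pq(3)] by (simp add: mult_neg_pos)
    moreover have "(\<Sum>j\<in>C - {q}. B p j * x j) \<le> 0" using nonpos[OF p(1)] by (intro sum_nonpos) auto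
    ultimately have "(\<Sum>j\<in>C. B p j * x j) < 0" using sum.remove[OF finC pq(3), of "\<lambda>j. B p j * x j"] by linarith
    then show False using null[of p] p(1) by simp
  qed
  then show "C = {k \<in> V. (v, k) \<in> ?E\<^sup>* \<and> (k, v) \<in> ?E\<^sup>*}" using D by simp
  show "\<exists>x. (\<forall>i\<in>C. 0 < x i) \<and> (\<forall>i\<in>C. (\<Sum>j\<in>C. B i j * x j) = 0)"
    using x(1) null CD by blast
qed

section \<open>The sign characterization and the spectral radius\<close>

lemma spectral_radius_smult_less_1:
  assumes P: "P \<in> carrier_mat n n" and n: "0 < n" and c: "0 < c" "spectral_radius P < c"
  shows "spectral_radius (complex_of_real (1 / c) \<cdot>\<^sub>m P) < 1"
proof -
  let ?Q = "complex_of_real (1 / c) \<cdot>\<^sub>m P"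
  have Q: "?Q \<in> carrier_mat n n" using P by simp
  obtain e where e: "eigenvalue ?Q e" "spectral_radius ?Q = norm e"
    using spectral_radius_mem_max(1)[OF Q n] unfolding spectrum_def by auto
  then obtain v where v: "v \<in> carrier_vec n" "v \<noteq> 0\<^sub>v n" "?Q *\<^sub>v v = e \<cdot>\<^sub>v v"
    using Q unfolding eigenvalue_def eigenvector_def by auto
  have "P *\<^sub>v v = complex_of_real c * e \<cdot>\<^sub>v v"
  proof (rule eq_vecI)
    fix i assume "i < dim_vec (complex_of_real c * e \<cdot>\<^sub>v v)"
    then have i: "i < n" using v by simp
    have "(?Q *\<^sub>v v) $ i = e * v $ i" unfolding v(3) using i v(1) by simp
    moreover have "(?Q *\<^sub>v v) $ i = complex_of_real (1 / c) * (P *\<^sub>v v) $ i"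
      using i P v(1) by simp
    ultimately show "(P *\<^sub>v v) $ i = (complex_of_real c * e \<cdot>\<^sub>v v) $ i"
      using i v(1) c(1) by (simp add: field_simps)
  qed (use P v in simp)
  then have "eigenvalue P (complex_of_real c * e)"
    unfolding eigenvalue_def eigenvector_def using v P by auto
  then have "norm (complex_of_real c * e) \<le> spectral_radius P"
    using spectral_radius_mem_max(2)[OF P n] unfolding spectrum_def by blast
  moreover have "norm (complex_of_real c * e) = c * norm e" using c(1) by (simp add: norm_mult)
  ultimately have "c * norm e < c * 1" using c(2) by linarith
  then show ?thesis using c(1) unfolding e(2) by (simp only: mult_less_cancel_left_pos)
qed

text \<open>If \<open>Px \<ge> \<beta>x\<close> for a nonzero \<open>x \<ge> 0\<close> with \<open>\<beta>\<close> above the spectral radius, then for \<open>\<gamma>\<close> strictly between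
  the two, \<open>(P/\<gamma>)\<^sup>k x \<ge> (\<beta>/\<gamma>)\<^sup>k x\<close> grows without bound, although the powers of \<open>P/\<gamma>\<close> are bounded.\<close>

lemma nonneg_mat_super_eigenvalue_le_spectral_radius:
  assumes P: "P \<in> carrier_mat n n" and nn: "\<And>i j. i < n \<Longrightarrow> j < n \<Longrightarrow> 0 \<le> P $$ (i, j)"
    and x: "\<And>i. i < n \<Longrightarrow> 0 \<le> x i" "i < n" "0 < x i"
    and super: "\<And>i. i < n \<Longrightarrow> \<beta> * x i \<le> (\<Sum>j<n. P $$ (i, j) * x j)"
  shows "\<beta> \<le> spectral_radius (map_mat complex_of_real P)"
proof (rule ccontr)
  let ?cP = "map_mat complex_of_real P"
  define \<rho> where "\<rho> = spectral_radius ?cP"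
  have cP: "?cP \<in> carrier_mat n n" using P by simp
  have n: "0 < n" using x(2) by simp
  have \<rho>: "0 \<le> \<rho>" using spectral_radius_mem_max(1)[OF cP n] unfolding \<rho>_def by auto
  assume "\<not> \<beta> \<le> spectral_radius ?cP"
  then have lt: "\<rho> < \<beta>" unfolding \<rho>_def by simp
  define \<gamma> where "\<gamma> = (\<rho> + \<beta>) / 2"
  have \<gamma>: "\<rho> < \<gamma>" "\<gamma> < \<beta>" "0 < \<gamma>" unfolding \<gamma>_def using lt \<rho> by auto
  define Q where "Q = (1 / \<gamma>) \<cdot>\<^sub>m P"
  have Q: "Q \<in> carrier_mat n n" unfolding Q_def using P by simp
  have Qk: "Q ^\<^sub>m k \<in> carrier_mat n n" for k using Q by simp
  have Qij: "Q $$ (i, j) = P $$ (i, j) / \<gamma>" if "i < n" "j < n" for i j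
    using that P unfolding Q_def by simp
  have cQ: "map_mat complex_of_real Q = complex_of_real (1 / \<gamma>) \<cdot>\<^sub>m ?cP"
    unfolding Q_def using P by (intro eq_matI) auto
  have "spectral_radius (map_mat complex_of_real Q) < 1"
    unfolding cQ using spectral_radius_smult_less_1[OF cP n \<gamma>(3)] \<gamma>(1) unfolding \<rho>_def by simp
  then obtain c where "\<And>k. norm_bound (map_mat complex_of_real Q ^\<^sub>m k) c"
    using spectral_radius_jnf_norm_bound_less_1_upper_triangular[of "map_mat complex_of_real Q" n] Q
    by auto
  then have "norm_bound (map_mat complex_of_real (Q ^\<^sub>m k)) c" for k
    using of_real_hom.mat_hom_pow[OF Q] by metis
  then have bound: "\<bar>(Q ^\<^sub>m k) $$ (i, j)\<bar> \<le> c" if "i < n" "j < n" for i j k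
    using that Q unfolding norm_bound_def by (auto split: if_splits)
  have step: "(Q ^\<^sub>m Suc k) $$ (i, j) = (\<Sum>l<n. (Q ^\<^sub>m k) $$ (i, l) * Q $$ (l, j))"
    if "i < n" "j < n" for i j k
    using that Q Qk[of k] by (simp add: scalar_prod_def atLeast0LessThan)
  have Q_nn: "0 \<le> (Q ^\<^sub>m k) $$ (i, j)" if "i < n" "j < n" for i j k
    using that
  proof (induction k arbitrary: i j)
    case 0
    then show ?case using Q by simp
  next
    case (Suc k)
    show ?case unfolding step[OF Suc.prems]
      using Suc nn \<gamma>(3) by (intro sum_nonneg mult_nonneg_nonneg) (auto simp: Qij)
  qed
  define t where "t = \<beta> / \<gamma>"
  have t: "1 < t" unfolding t_def using \<gamma> by simp
  have Q_super: "t * x i \<le> (\<Sum>j<n. Q $$ (i, j) * x j)" if "i < n" for i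
  proof -
    have "t * x i \<le> (\<Sum>j<n. P $$ (i, j) * x j) / \<gamma>"
      unfolding t_def using super[OF that] \<gamma>(3) by (simp add: divide_right_mono)
    then show ?thesis using that by (simp add: Qij sum_divide_distrib)
  qed
  have grow: "t ^ k * x i \<le> (\<Sum>j<n. (Q ^\<^sub>m k) $$ (i, j) * x j)" if "i < n" for i k
    using that
  proof (induction k)
    case 0
    have "(\<Sum>j<n. (Q ^\<^sub>m 0) $$ (i, j) * x j) = (\<Sum>j<n. if j = i then x i else 0)"
      using 0 Q by (intro sum.cong) auto
    then show ?case using 0 by simp
  next
    case (Suc k)
    have "t ^ Suc k * x i \<le> t * (\<Sum>l<n. (Q ^\<^sub>m k) $$ (i, l) * x l)"
      using Suc t by simp
    also have "\<dots> = (\<Sum>l<n. (Q ^\<^sub>m k) $$ (i, l) * (t * x l))"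
      by (simp add: sum_distrib_left algebra_simps)
    also have "\<dots> \<le> (\<Sum>l<n. (Q ^\<^sub>m k) $$ (i, l) * (\<Sum>j<n. Q $$ (l, j) * x j))"
      using Suc.prems Q_nn Q_super by (intro sum_mono mult_left_mono) auto
    also have "\<dots> = (\<Sum>l<n. \<Sum>j<n. (Q ^\<^sub>m k) $$ (i, l) * Q $$ (l, j) * x j)"
      by (simp add: sum_distrib_left mult.assoc)
    also have "\<dots> = (\<Sum>j<n. (\<Sum>l<n. (Q ^\<^sub>m k) $$ (i, l) * Q $$ (l, j)) * x j)"
      by (subst sum.swap) (simp add: sum_distrib_right)
    also have "\<dots> = (\<Sum>j<n. (Q ^\<^sub>m Suc k) $$ (i, j) * x j)"
      using Suc.prems by (intro sum.cong) (simp_all only: step lessThan_iff)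
    finally show ?case .
  qed
  have "t ^ k \<le> (\<Sum>j<n. c * x j) / x i" for k
  proof -
    have "t ^ k * x i \<le> (\<Sum>j<n. (Q ^\<^sub>m k) $$ (i, j) * x j)" by (rule grow[OF x(2)])
    also have "\<dots> \<le> (\<Sum>j<n. c * x j)"
    proof (rule sum_mono, rule mult_right_mono)
      fix j assume j: "j \<in> {..<n}"
      show "(Q ^\<^sub>m k) $$ (i, j) \<le> c" using bound[of i j k] x(2) j by simp
      show "0 \<le> x j" using x(1) j by simp
    qed
    finally show ?thesis using x(3) by (simp add: pos_le_divide_eq)
  qed
  moreover obtain k where "(\<Sum>j<n. c * x j) / x i < t ^ k" using real_arch_pow[OF t] by blast
  ultimately show False by (meson not_le)
qed

lemma M_matrix_imp_M_on:
  assumes "M_matrix n A"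
  shows "A \<in> carrier_mat n n" and "M_on {..<n} (\<lambda>i j. A $$ (i, j))"
proof -
  obtain \<alpha> P where P: "P \<in> carrier_mat n n" and nn: "\<And>i j. i < n \<Longrightarrow> j < n \<Longrightarrow> 0 \<le> P $$ (i, j)"
    and \<alpha>: "spectral_radius (map_mat complex_of_real P) \<le> \<alpha>" and A: "A = \<alpha> \<cdot>\<^sub>m 1\<^sub>m n - P"
    using assms unfolding M_matrix_def by blast
  show "A \<in> carrier_mat n n" unfolding A using P by (simp add: minus_carrier_mat)
  have Aij: "A $$ (i, j) = (if i = j then \<alpha> else 0) - P $$ (i, j)" if "i < n" "j < n" for i j
    unfolding A using P that by simp
  show "M_on {..<n} (\<lambda>i j. A $$ (i, j))"
    unfolding M_on_def
  proof (intro conjI allI impI)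
    show "\<forall>i\<in>{..<n}. \<forall>j\<in>{..<n}. i \<noteq> j \<longrightarrow> A $$ (i, j) \<le> 0" using Aij nn by simp
    fix C x assume C: "C \<subseteq> {..<n}" "C \<noteq> {}" and x: "\<forall>i\<in>C. 0 < (x i :: real)"
    have fin: "finite C" using C(1) finite_subset by blast
    show "\<exists>i\<in>C. 0 \<le> (\<Sum>j\<in>C. A $$ (i, j) * x j)"
    proof (rule ccontr)
      assume "\<not> ?thesis"
      then have neg: "(\<Sum>j\<in>C. A $$ (i, j) * x j) < 0" if "i \<in> C" for i
        using that by (simp add: not_le)
      obtain d where d: "0 < d" "\<And>i. i \<in> C \<Longrightarrow> (\<Sum>j\<in>C. A $$ (i, j) * x j) + d * x i < 0"
        by (rule obtain_small_step[OF fin neg, where g = x]) auto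
      define y where "y i = (if i \<in> C then x i else 0)" for i
      have y0: "0 \<le> y i" for i unfolding y_def using x by (auto intro: less_imp_le)
      have sum_y: "(\<Sum>j<n. P $$ (i, j) * y j) = (\<Sum>j\<in>C. P $$ (i, j) * x j)" for i
      proof -
        have "(\<Sum>j<n. P $$ (i, j) * y j) = (\<Sum>j\<in>C. P $$ (i, j) * y j)"
          using C(1) by (intro sum.mono_neutral_right) (auto simp: y_def)
        then show ?thesis by (simp add: y_def)
      qed
      have sumA: "(\<Sum>j\<in>C. A $$ (i, j) * x j) = \<alpha> * x i - (\<Sum>j\<in>C. P $$ (i, j) * x j)" if "i \<in> C" for i
      proof -
        have "(\<Sum>j\<in>C. A $$ (i, j) * x j)
            = (\<Sum>j\<in>C. (if j = i then \<alpha> * x i else 0) - P $$ (i, j) * x j)"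
          using C(1) that by (intro sum.cong) (auto simp: Aij subset_iff algebra_simps)
        then show ?thesis using fin that by (simp add: sum_subtractf)
      qed
      have super: "(\<alpha> + d) * y i \<le> (\<Sum>j<n. P $$ (i, j) * y j)" if "i < n" for i
      proof (cases "i \<in> C")
        case True
        then show ?thesis using d(2)[OF True] sumA[OF True]
          unfolding sum_y by (simp add: y_def algebra_simps)
      next
        case False
        have "0 \<le> (\<Sum>j<n. P $$ (i, j) * y j)"
          using nn that y0 by (intro sum_nonneg mult_nonneg_nonneg) auto
        then show ?thesis using False by (simp add: y_def)
      qed
      obtain i where i: "i \<in> C" using C(2) by blast
      then have "i < n" "0 < y i" using C(1) x unfolding y_def by auto
      then have "\<alpha> + d \<le> spectral_radius (map_mat complex_of_real P)"
        by (intro nonneg_mat_super_eigenvalue_le_spectral_radius[OF P nn y0 _ _ super])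
      then show False using \<alpha> d(1) by simp
    qed
  qed
qed

text \<open>Write \<open>A = \<alpha>I - P\<close> with \<open>P \<ge> 0\<close>. An eigenvalue \<open>e\<close> of \<open>P\<close> of modulus above \<open>\<alpha>\<close> is impossible:
  with \<open>x\<close> the entrywise modulus of an eigenvector and \<open>C\<close> its support, \<open>P\<^sub>C\<^sub>C x \<ge> \<bar>e\<bar> x > \<alpha>x\<close>, so
  all entries of \<open>A\<^sub>C\<^sub>C x\<close> are negative.\<close>

lemma M_on_imp_M_matrix:
  assumes A: "A \<in> carrier_mat n n" and M: "M_on {..<n} (\<lambda>i j. A $$ (i, j))"
  shows "M_matrix n A"
proof (cases "n = 0")
  case True
  \<comment> \<open>The spectral radius of the empty matrix is an unspecified number, which serves as its own
    bound.\<close>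
  show ?thesis unfolding M_matrix_def
    by (intro exI[of _ "spectral_radius (map_mat complex_of_real A)"] exI[of _ A])
       (use A True in \<open>auto intro!: eq_matI\<close>)
next
  case False
  then have n: "0 < n" by simp
  define \<alpha> where "\<alpha> = (\<Sum>i<n. \<bar>A $$ (i, i)\<bar>)"
  define P where "P = \<alpha> \<cdot>\<^sub>m 1\<^sub>m n - A"
  let ?cP = "map_mat complex_of_real P"
  have P: "P \<in> carrier_mat n n" unfolding P_def using A by (simp add: minus_carrier_mat)
  then have cP: "?cP \<in> carrier_mat n n" by simp
  have Aij: "A $$ (i, j) = (if i = j then \<alpha> else 0) - P $$ (i, j)" if "i < n" "j < n" for i j
    unfolding P_def using A that by simp
  have diag: "A $$ (i, i) \<le> \<alpha>" if "i < n" for i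
  proof -
    have "\<bar>A $$ (i, i)\<bar> \<le> \<alpha>" unfolding \<alpha>_def using that by (intro member_le_sum) auto
    then show ?thesis by simp
  qed
  have nn: "0 \<le> P $$ (i, j)" if "i < n" "j < n" for i j
    using M_on_offdiag[OF M, of i j] diag[of i] Aij[OF that] that by (auto split: if_splits)
  have "spectral_radius ?cP \<le> \<alpha>"
  proof (rule ccontr)
    assume gt: "\<not> spectral_radius ?cP \<le> \<alpha>"
    obtain e where e: "eigenvalue ?cP e" "spectral_radius ?cP = norm e"
      using spectral_radius_mem_max(1)[OF cP n] unfolding spectrum_def by auto
    then obtain v where v: "v \<in> carrier_vec n" "v \<noteq> 0\<^sub>v n" "?cP *\<^sub>v v = e \<cdot>\<^sub>v v"
      using cP unfolding eigenvalue_def eigenvector_def by auto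
    define C where "C = {i. i < n \<and> v $ i \<noteq> 0}"
    define x where "x i = norm (v $ i)" for i
    have C: "C \<subseteq> {..<n}" "finite C" unfolding C_def by auto
    have ne: "C \<noteq> {}"
    proof
      assume "C = {}"
      then have "v = 0\<^sub>v n" using v(1) unfolding C_def by (intro eq_vecI) auto
      then show False using v(2) by simp
    qed
    have x: "0 < x i" if "i \<in> C" for i using that unfolding C_def x_def by simp
    obtain i where i: "i \<in> C" "0 \<le> (\<Sum>j\<in>C. A $$ (i, j) * x j)"
      using M_on_not_neg[OF M C(1) ne, of x] x by blast
    have iN: "i < n" using i(1) C(1) by auto
    have "norm e * x i = norm ((?cP *\<^sub>v v) $ i)"
      unfolding v(3) x_def using iN v(1) by (simp add: norm_mult)
    also have "(?cP *\<^sub>v v) $ i = (\<Sum>j<n. complex_of_real (P $$ (i, j)) * v $ j)"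
      using iN P v(1) by (simp add: scalar_prod_def atLeast0LessThan)
    also have "norm \<dots> \<le> (\<Sum>j<n. norm (complex_of_real (P $$ (i, j)) * v $ j))"
      by (rule norm_sum)
    also have "\<dots> = (\<Sum>j<n. P $$ (i, j) * x j)"
      using nn iN by (intro sum.cong) (auto simp: norm_mult x_def)
    also have "\<dots> = (\<Sum>j\<in>C. P $$ (i, j) * x j)"
      by (intro sum.mono_neutral_right) (auto simp: C_def x_def)
    finally have le: "norm e * x i \<le> (\<Sum>j\<in>C. P $$ (i, j) * x j)" .
    have "(\<Sum>j\<in>C. A $$ (i, j) * x j)
        = (\<Sum>j\<in>C. (if j = i then \<alpha> * x i else 0) - P $$ (i, j) * x j)"
      using C(1) iN by (intro sum.cong) (auto simp: Aij subset_iff algebra_simps)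
    also have "\<dots> = \<alpha> * x i - (\<Sum>j\<in>C. P $$ (i, j) * x j)"
      using C(2) i(1) by (simp add: sum_subtractf)
    finally have "norm e * x i \<le> \<alpha> * x i" using le i(2) by simp
    then show False using gt x[OF i(1)] unfolding e(2) by simp
  qed
  moreover have "A = \<alpha> \<cdot>\<^sub>m 1\<^sub>m n - P"
    using A P by (intro eq_matI) (auto simp: Aij)
  ultimately show ?thesis unfolding M_matrix_def using P nn by blast
qed

section \<open>Singular classes of a matrix\<close>

lemma bij_betw_pick:
  assumes "finite C"
  shows "bij_betw (pick C) {..<card C} C"
proof -
  have inj: "inj_on (pick C) {..<card C}"
    by (intro linorder_inj_onI') (use pick_mono_le in force)
  moreover have "pick C ` {..<card C} \<subseteq> C" using pick_in_set_le by auto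
  ultimately have "pick C ` {..<card C} = C"
    using assms by (intro card_subset_eq) (auto simp: card_image)
  then show ?thesis using inj unfolding bij_betw_def by simp
qed

lemma singular_submatrix:
  fixes A :: "real mat"
  assumes A: "A \<in> carrier_mat n n" and C: "C \<subseteq> {..<n}" "C \<noteq> {}"
    and x: "\<And>i. i \<in> C \<Longrightarrow> 0 < x i" "\<And>i. i \<in> C \<Longrightarrow> (\<Sum>j\<in>C. A $$ (i, j) * x j) = 0"
  shows "\<not> invertible_mat (submatrix A C C)"
proof
  let ?M = "submatrix A C C"
  define m where "m = card C"
  have fin: "finite C" using C(1) finite_subset by blast
  have m: "0 < m" unfolding m_def using fin C(2) by (simp add: card_gt_0_iff)
  have CA: "{i. i < dim_row A \<and> i \<in> C} = C" "{i. i < dim_col A \<and> i \<in> C} = C" using A C(1) by auto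
  have M: "?M \<in> carrier_mat m m" unfolding m_def carrier_mat_def by (simp add: dim_submatrix CA)
  define w where "w = vec m (\<lambda>k. x (pick C k))"
  have w: "w \<in> carrier_vec m" unfolding w_def by simp
  have pickC: "pick C k \<in> C" if "k < m" for k using that pick_in_set_le unfolding m_def by blast
  have null: "?M *\<^sub>v w = 0\<^sub>v m"
  proof (rule eq_vecI)
    fix k assume "k < dim_vec (0\<^sub>v m :: real vec)"
    then have k: "k < m" by simp
    have "(?M *\<^sub>v w) $ k = (\<Sum>l<m. ?M $$ (k, l) * x (pick C l))"
      using k M by (simp add: scalar_prod_def w_def atLeast0LessThan)
    also have "\<dots> = (\<Sum>l<m. A $$ (pick C k, pick C l) * x (pick C l))"
      using k unfolding m_def by (intro sum.cong) (auto simp: submatrix_index CA)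
    also have "\<dots> = (\<Sum>j\<in>C. A $$ (pick C k, j) * x j)"
      unfolding m_def by (rule sum.reindex_bij_betw[OF bij_betw_pick[OF fin]])
    also have "\<dots> = 0" using x(2) pickC[OF k] by blast
    finally show "(?M *\<^sub>v w) $ k = 0\<^sub>v m $ k" using k by simp
  qed (use M in simp)
  assume "invertible_mat ?M"
  then obtain B where B: "?M * B = 1\<^sub>m (dim_row ?M)" "B * ?M = 1\<^sub>m (dim_row B)"
    unfolding invertible_mat_def inverts_mat_def by blast
  have "dim_col B = m" using arg_cong[OF B(1), of dim_col] M by simp
  moreover have "dim_row B = m" using arg_cong[OF B(2), of dim_col] M by simp
  ultimately have Bc: "B \<in> carrier_mat m m" by blast
  have "w = (B * ?M) *\<^sub>v w" unfolding B(2) using Bc w by simp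
  also have "\<dots> = B *\<^sub>v (?M *\<^sub>v w)" by (rule assoc_mult_mat_vec[OF Bc M w])
  also have "\<dots> = 0\<^sub>v m" unfolding null using Bc by (intro eq_vecI) (auto simp: scalar_prod_def)
  finally have "w $ 0 = 0" using m by simp
  then show False using x(1)[OF pickC[OF m]] m unfolding w_def by simp
qed

lemma graph_of_eq_edges_on: "graph_of n A = edges_on {..<n} (\<lambda>i j. A $$ (i, j))"
  unfolding graph_of_def edges_on_def by simp

lemma critical_imp_singular_class:
  assumes "M_matrix n A" and crit: "critical {..<n} (\<lambda>i j. A $$ (i, j)) C"
  shows "C \<in> singular_classes n A"
proof -
  note A = M_matrix_imp_M_on[OF assms(1)]
  have C: "C \<noteq> {}" "C \<subseteq> {..<n}" using crit unfolding critical_def by auto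
  then obtain v where v: "v \<in> C" by blast
  have fin: "finite {..<n}" by simp
  note * = critical_is_class[OF fin A(2) crit v, folded graph_of_eq_edges_on]
  have "C = {(j, k). has_access n A j k \<and> has_access n A k j} `` {v}"
    using *(1) v C(2) unfolding has_access_def by auto
  moreover have "v \<in> {..<n}" using v C(2) by blast
  ultimately have "C \<in> matrix_classes n A"
    unfolding matrix_classes_def by (simp only: quotientI)
  moreover have "\<not> invertible_mat (submatrix A C C)"
    using singular_submatrix[OF A(1) C(2,1)] *(2) by blast
  ultimately show ?thesis unfolding singular_classes_def by blast
qed

section \<open>Order preserving partitions\<close>

text \<open>Two indices lie in a common block of the partition \<open>Y\<close>.\<close>

definition same_block :: "nat set list \<Rightarrow> nat \<Rightarrow> nat \<Rightarrow> bool" where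
  "same_block Y i j \<longleftrightarrow> (\<exists>y\<in>set Y. i \<in> y \<and> j \<in> y)"

lemma opp_blockE:
  assumes "order_preserving_partition n Y" "i < n"
  obtains y where "y \<in> set Y" "i \<in> y"
proof -
  have "i \<in> \<Union> (set Y)" using assms unfolding order_preserving_partition_def by simp
  then show ?thesis using that by blast
qed

lemma opp_block_subset:
  assumes "order_preserving_partition n Y" "y \<in> set Y"
  shows "y \<subseteq> {..<n}"
  using assms unfolding order_preserving_partition_def by (metis Sup_upper)

lemma same_block_convex:
  assumes Y: "order_preserving_partition n Y" and "p \<le> q" "q \<le> r" "same_block Y p r"
  shows "same_block Y q r"
proof -
  obtain y where y: "y \<in> set Y" "p \<in> y" "r \<in> y" using assms(4) unfolding same_block_def by blast
  then have "q < n" using opp_block_subset[OF Y y(1)] assms(3) by auto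
  then obtain z where z: "z \<in> set Y" "q \<in> z" by (rule opp_blockE[OF Y])
  obtain a b where ab: "a < length Y" "Y ! a = y" "b < length Y" "Y ! b = z"
    using y(1) z(1) by (metis in_set_conv_nth)
  have ord: "k \<le> k'"
    if "k < length Y" "k' < length Y" "i \<in> Y ! k" "j \<in> Y ! k'" "i < j" for k k' i j
    using Y that unfolding order_preserving_partition_def by blast
  show ?thesis
  proof (cases "p = q \<or> q = r")
    case True
    then show ?thesis using y unfolding same_block_def by blast
  next
    case False
    then have "a \<le> b" "b \<le> a" using ord[of a b p q] ord[of b a q r] ab y z assms(2,3) by auto
    then have "y = z" using ab by simp
    then show ?thesis using y z unfolding same_block_def by blast
  qed
qed

lemma is_glb_glb_partition:
  assumes "\<And>Y. Y \<in> C \<Longrightarrow> order_preserving_partition n Y"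
  shows "is_glb_partition n C (glb_partition n C)"
  unfolding glb_partition_def by (rule theI'[OF ex1_glb_partition[OF assms]])

lemma finest_encompassing_opp:
  "order_preserving_partition n (finest_encompassing n \<J>)"
  using is_glb_glb_partition[of "{Y. order_preserving_partition n Y \<and> encompasses Y \<J>}" n]
  unfolding finest_encompassing_def is_glb_partition_def by simp

text \<open>Encompassing an interval \<open>F\<close> passes to the greatest lower bound: the partition into \<open>F\<close> and
  singletons refines every partition that encompasses \<open>F\<close>, hence refines their greatest lower
  bound.\<close>

lemma finest_encompassing_encompasses:
  assumes "F \<in> \<J>" "F \<noteq> {}" "F \<subseteq> {..<n}"
    and convex: "\<And>i j k. i \<in> F \<Longrightarrow> k \<in> F \<Longrightarrow> i \<le> j \<Longrightarrow> j \<le> k \<Longrightarrow> j \<in> F"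
  shows "\<exists>y\<in>set (finest_encompassing n \<J>). F \<subseteq> y"
proof -
  let ?C = "{Y. order_preserving_partition n Y \<and> encompasses Y \<J>}"
  have glb: "is_glb_partition n ?C (finest_encompassing n \<J>)"
    unfolding finest_encompassing_def by (rule is_glb_glb_partition) simp
  define E where "E = {(i, j). i < n \<and> j < n \<and> (i = j \<or> i \<in> F \<and> j \<in> F)}"
  have "equiv {..<n} E"
    by (rule equivI) (auto simp: E_def refl_on_def sym_def trans_def)
  moreover have "(i, j) \<in> E" if "(i, k) \<in> E" "i \<le> j" "j \<le> k" for i j k
    using that convex[of i k j] unfolding E_def by auto
  ultimately have "\<exists>Z. order_preserving_partition n Z \<and> set Z = {..<n} // E"
    by (rule opp_of_equiv)
  then obtain Z where Z: "order_preserving_partition n Z" "set Z = {..<n} // E" by blast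
  have cls: "E `` {i} = (if i \<in> F then F else {i})" if "i < n" for i
    using that assms(3) unfolding E_def by auto
  have "refinement n Z Y" if Y: "order_preserving_partition n Y" "encompasses Y \<J>" for Y
    unfolding refinement_def
  proof (intro conjI ballI Z(1) Y(1))
    fix z assume "z \<in> set Z"
    then obtain i where i: "i < n" "z = E `` {i}" unfolding Z(2) quotient_def by auto
    show "\<exists>y\<in>set Y. z \<subseteq> y"
    proof (cases "i \<in> F")
      case True
      then show ?thesis using Y(2) assms(1) cls[OF i(1)] i(2) unfolding encompasses_def by simp
    next
      case False
      then show ?thesis using opp_blockE[OF Y(1) i(1)] cls[OF i(1)] i(2) by auto
    qed
  qed
  then have "refinement n Z (finest_encompassing n \<J>)"
    using glb Z(1) unfolding is_glb_partition_def by blast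
  moreover have "F \<in> set Z"
  proof -
    obtain i where i: "i \<in> F" "i < n" using assms(2,3) by auto
    then have "F = E `` {i}" using cls by simp
    then show ?thesis unfolding Z(2) using i(2) by (auto intro: quotientI)
  qed
  ultimately show ?thesis unfolding refinement_def by blast
qed

lemma submatrix_eq_0:
  assumes X: "X \<in> carrier_mat n n" and "I \<subseteq> {..<n}" "J \<subseteq> {..<n}"
    and zero: "\<And>i j. i \<in> I \<Longrightarrow> j \<in> J \<Longrightarrow> X $$ (i, j) = 0"
  shows "submatrix X I J = 0\<^sub>m (card I) (card J)"
proof -
  have eq: "{i. i < dim_row X \<and> i \<in> I} = I" "{j. j < dim_col X \<and> j \<in> J} = J"
    using assms(1-3) by auto
  show ?thesis
    by (rule eq_matI)
      (auto simp: dim_submatrix eq submatrix_index intro!: zero pick_in_set_le)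
qed

text \<open>A partition is refined by the self-partition as soon as every entry on the wrong side of the
  diagonal stays within a block.\<close>

lemma refinement_self_partition:
  assumes X: "X \<in> carrier_mat n n" and Y: "order_preserving_partition n Y"
  shows "(\<And>i j. i < j \<Longrightarrow> j < n \<Longrightarrow> X $$ (i, j) \<noteq> 0 \<Longrightarrow> same_block Y i j) \<Longrightarrow>
           refinement n (lower_self_partition n X) Y"
    and "(\<And>i j. i < j \<Longrightarrow> j < n \<Longrightarrow> X $$ (j, i) \<noteq> 0 \<Longrightarrow> same_block Y i j) \<Longrightarrow>
           refinement n (upper_self_partition n X) Y"
proof -
  have sub: "v \<subseteq> {..<n}" "above n v \<subseteq> {..<n}" if "v \<in> set Y" for v
    using opp_block_subset[OF Y that] unfolding above_def by auto
  have sep: "i < j \<and> j < n \<and> \<not> same_block Y i j" if v: "v \<in> set Y" "i \<in> v" "j \<in> above n v" for v i j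
  proof -
    have fin: "finite v" using sub(1)[OF v(1)] finite_subset by blast
    have "i \<le> Max v" using fin v(2) by simp
    then have "i < j" "j < n" "j \<notin> v" using v(3) Max_ge[OF fin, of j] unfolding above_def by auto
    moreover have "j \<in> v" if "same_block Y i j"
      using that opp_block_unique[OF Y _ v(1) _ v(2)] unfolding same_block_def by blast
    ultimately show ?thesis by blast
  qed
  {
    assume "\<And>i j. i < j \<Longrightarrow> j < n \<Longrightarrow> X $$ (i, j) \<noteq> 0 \<Longrightarrow> same_block Y i j"
    then have "submatrix X v (above n v) = 0\<^sub>m (card v) (card (above n v))" if "v \<in> set Y" for v
      using submatrix_eq_0[OF X sub[OF that]] sep[OF that] by blast
    then show "refinement n (lower_self_partition n X) Y"
      using is_glb_glb_partition[of "{Y. order_preserving_partition n Y \<and>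
         (\<forall>v\<in>set Y. submatrix X v (above n v) = 0\<^sub>m (card v) (card (above n v)))}" n] Y
      unfolding lower_self_partition_def is_glb_partition_def by simp
  next
    assume "\<And>i j. i < j \<Longrightarrow> j < n \<Longrightarrow> X $$ (j, i) \<noteq> 0 \<Longrightarrow> same_block Y i j"
    then have "submatrix X (above n v) v = 0\<^sub>m (card (above n v)) (card v)" if "v \<in> set Y" for v
      using submatrix_eq_0[OF X sub(2)[OF that] sub(1)[OF that]] sep[OF that] by blast
    then show "refinement n (upper_self_partition n X) Y"
      using is_glb_glb_partition[of "{Y. order_preserving_partition n Y \<and>
         (\<forall>v\<in>set Y. submatrix X (above n v) v = 0\<^sub>m (card (above n v)) (card v))}" n] Y
      unfolding upper_self_partition_def is_glb_partition_def by simp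
  }
qed

section \<open>The factorization theorem\<close>

theorem theorem3p7:
  fixes n m :: nat and A :: "real mat" and S :: "nat \<Rightarrow> nat set" and J K :: "nat set"
  assumes "M_matrix n A"
    and "S ` {1..m} = singular_classes n A"
    and "\<forall>i. 1 \<le> i \<and> i < m \<longrightarrow> Max (S i) < Max (S (Suc i))"
    and "J \<union> K = {1..m}" and "J \<inter> K = {}"
  shows "\<exists>L U. A = L * U \<and> M_matrix n L \<and> M_matrix n U \<and>
           refinement n (lower_self_partition n L)
             (finest_encompassing n ((\<lambda>i. F_set n A (S i)) ` J)) \<and>
           refinement n (upper_self_partition n U)
             (finest_encompassing n ((\<lambda>i. T_set n A (S i)) ` K))"
proof -
  let ?B = "\<lambda>i j. A $$ (i, j)"
  define \<Psi> where "\<Psi> = finest_encompassing n ((\<lambda>i. F_set n A (S i)) ` J)"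
  define \<Upsilon> where "\<Upsilon> = finest_encompassing n ((\<lambda>i. T_set n A (S i)) ` K)"
  have opp: "order_preserving_partition n \<Psi>" "order_preserving_partition n \<Upsilon>"
    unfolding \<Psi>_def \<Upsilon>_def by (rule finest_encompassing_opp)+
  note A = M_matrix_imp_M_on[OF assms(1)]
  have crit: "(\<forall>w\<ge>Max C. (Max C, w) \<in> (edges_on {..<n} ?B)\<^sup>* \<longrightarrow> same_block \<Psi> (Max C) w) \<or>
         (\<forall>w\<ge>Max C. (w, Max C) \<in> (edges_on {..<n} ?B)\<^sup>* \<longrightarrow> same_block \<Upsilon> (Max C) w)"
    if C: "critical {..<n} ?B C" for C
  proof -
    have "C \<in> singular_classes n A" by (rule critical_imp_singular_class[OF assms(1) C])
    then obtain i where i: "i \<in> {1..m}" "S i = C" using assms(2) by (metis imageE)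
    have C': "C \<noteq> {}" "C \<subseteq> {..<n}" using C unfolding critical_def by auto
    then have "finite C" using finite_subset by blast
    then have max: "Max C \<in> C" "Max C < n" using C' by auto
    have reach: "w < n" if "(Max C, w) \<in> (graph_of n A)\<^sup>*" for w
      using that max(2) by (induction rule: rtrancl_induct) (auto simp: graph_of_def)
    have reach': "w < n" if "(w, Max C) \<in> (graph_of n A)\<^sup>*" for w
      using that max(2) by (induction rule: converse_rtrancl_induct) (auto simp: graph_of_def)
    consider "i \<in> J" | "i \<in> K" using i(1) assms(4) by blast
    then show ?thesis
    proof cases
      case 1
      let ?F = "F_set n A C"
      have MF: "Max C \<in> ?F"
        unfolding F_set_def has_access_def using max by blast
      have "\<exists>y\<in>set \<Psi>. ?F \<subseteq> y"
        unfolding \<Psi>_def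
      proof (rule finest_encompassing_encompasses)
        show "?F \<in> (\<lambda>i. F_set n A (S i)) ` J" using 1 i(2) by blast
        show "?F \<noteq> {}" using MF by blast
        show "?F \<subseteq> {..<n}" unfolding F_set_def by auto
        show "b \<in> ?F" if "a \<in> ?F" "c \<in> ?F" "a \<le> b" "b \<le> c" for a b c
          using that unfolding F_set_def by (auto intro: order_trans)
      qed
      then obtain y where y: "y \<in> set \<Psi>" "?F \<subseteq> y" by blast
      have "w \<in> ?F" if "Max C \<le> w" "(Max C, w) \<in> (graph_of n A)\<^sup>*" for w
        unfolding F_set_def has_access_def using that max reach by blast
      then show ?thesis
        using y MF unfolding same_block_def graph_of_eq_edges_on by blast
    next
      case 2
      let ?T = "T_set n A C"
      have MT: "Max C \<in> ?T"
        unfolding T_set_def has_access_def using max by blast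
      have "\<exists>y\<in>set \<Upsilon>. ?T \<subseteq> y"
        unfolding \<Upsilon>_def
      proof (rule finest_encompassing_encompasses)
        show "?T \<in> (\<lambda>i. T_set n A (S i)) ` K" using 2 i(2) by blast
        show "?T \<noteq> {}" using MT by blast
        show "?T \<subseteq> {..<n}" unfolding T_set_def by auto
        show "b \<in> ?T" if "a \<in> ?T" "c \<in> ?T" "a \<le> b" "b \<le> c" for a b c
          using that unfolding T_set_def by (auto intro: order_trans)
      qed
      then obtain y where y: "y \<in> set \<Upsilon>" "?T \<subseteq> y" by blast
      have "w \<in> ?T" if "Max C \<le> w" "(w, Max C) \<in> (graph_of n A)\<^sup>*" for w
        unfolding T_set_def has_access_def using that max reach' by blast
      then show ?thesis
        using y MT unfolding same_block_def graph_of_eq_edges_on by blast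
    qed
  qed
  have "\<exists>L U. M_on {..<n} L \<and> M_on {..<n} U \<and>
      (\<forall>i\<in>{..<n}. \<forall>j\<in>{..<n}. A $$ (i, j) = (\<Sum>k<n. L i k * U k j)) \<and>
      (\<forall>i\<in>{..<n}. \<forall>j\<in>{..<n}. i < j \<longrightarrow> L i j \<noteq> 0 \<longrightarrow> same_block \<Psi> i j) \<and>
      (\<forall>i\<in>{..<n}. \<forall>j\<in>{..<n}. i < j \<longrightarrow> U j i \<noteq> 0 \<longrightarrow> same_block \<Upsilon> i j)"
    by (rule M_on_block_LU[OF finite_lessThan A(2) crit])
       (auto intro: same_block_convex[OF opp(1)] same_block_convex[OF opp(2)])
  then obtain L U where L: "M_on {..<n} L" and U: "M_on {..<n} U"
    and LU: "\<forall>i\<in>{..<n}. \<forall>j\<in>{..<n}. A $$ (i, j) = (\<Sum>k<n. L i k * U k j)"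
    and EL: "\<forall>i\<in>{..<n}. \<forall>j\<in>{..<n}. i < j \<longrightarrow> L i j \<noteq> 0 \<longrightarrow> same_block \<Psi> i j"
    and EU: "\<forall>i\<in>{..<n}. \<forall>j\<in>{..<n}. i < j \<longrightarrow> U j i \<noteq> 0 \<longrightarrow> same_block \<Upsilon> i j"
    by (elim exE conjE)
  define Lm where "Lm = mat n n (\<lambda>(i, j). L i j)"
  define Um where "Um = mat n n (\<lambda>(i, j). U i j)"
  have carr: "Lm \<in> carrier_mat n n" "Um \<in> carrier_mat n n" unfolding Lm_def Um_def by auto
  have "M_matrix n Lm" "M_matrix n Um"
    using M_on_cong[OF _ L] M_on_cong[OF _ U] carr
    by (auto intro!: M_on_imp_M_matrix simp: Lm_def Um_def)
  moreover have "A = Lm * Um"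
    using A(1) LU by (intro eq_matI)
      (auto simp: Lm_def Um_def scalar_prod_def atLeast0LessThan)
  moreover have "refinement n (lower_self_partition n Lm) \<Psi>"
    using EL by (intro refinement_self_partition(1)[OF carr(1) opp(1)]) (auto simp: Lm_def)
  moreover have "refinement n (upper_self_partition n Um) \<Upsilon>"
    using EU by (intro refinement_self_partition(2)[OF carr(2) opp(2)]) (auto simp: Um_def)
  ultimately show ?thesis unfolding \<Psi>_def \<Upsilon>_def by blast
qed

end
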